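(* Assume that there exists $\delta>0$ such that $$\sup_{x\in E}\mathbb{E}\left(e^{\delta\, d(F(x,W_1),F(x,W_2))^2}\right)<+\infty .$$ If there exists $0\le r<1$ such that $$\mathbb{E}\big(d(F(x,W_1),F(\tilde x,W_1))\big)\le r\,d(x,\tilde x)\qquad\forall x,\tilde x\in E,$$ or, more generally, if for some constant $S\ge 0$ $$\sum_{n=1}^\infty\mathbb{E}\big(d(X_n(x),X_n(\tilde x))\big)\le S\,d(x,\tilde x)\qquad\forall x,\tilde x\in E,$$ then there is some constant $C>0$ such that for every $x\in E$, any $n\ge 1$ and every probability measure $\mathbb{Q}^n$ on $E^n$, $$W_1^{d_{l_1}}(\mathbb{Q}^n,\mathbb{P}_x^n)\le\sqrt{C\,n\,H(\mathbb{Q}^n/\mathbb{P}_x^n)},$$ where $\mathbb{P}_x^n$ is the law of $(X_k(x))_{1\le k\le n}$ on $E^n$.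
   Context: $E$ is a complete connected Riemannian manifold with Riemannian metric (distance) $d$. $(W_n)_{n\ge 0}$ is a sequence of i.i.d. random variables with values in a measurable space $(G,\mathcal{G})$, defined on a probability space $(\Omega,\mathcal{F},\mathbb{P})$, and $F:E\times G\to E$ is measurable. The random dynamical system is $$X_0(x):=x\in E,\qquad X_{n+1}(x)=F(X_n(x),W_{n+1}),\quad n\ge 0.$$ On $E^n$, $d_{l_1}(x,y)=\sum_{i=1}^n d(x_i,y_i)$; $W_1^{d_{l_1}}(\mu,\nu)=\inf_\pi\iint d_{l_1}(x,y)\,d\pi(x,y)$ over all couplings $\pi$ of $(\mu,\nu)$; $H(\nu/\mu)=\int\log\frac{d\nu}{d\mu}\,d\nu$ if $\nu\ll\mu$ and $+\infty$ otherwise. *)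

theory Defs
  imports "HOL-Probability.Probability"
begin

section \<open>Riemannian manifolds\<close>

primrec Ck_on :: "nat \<Rightarrow> 'b::real_normed_vector set \<Rightarrow> ('b \<Rightarrow> 'c::real_normed_vector) \<Rightarrow> bool" where
  "Ck_on 0 S f \<longleftrightarrow> continuous_on S f"
| "Ck_on (Suc k) S f \<longleftrightarrow>
     (\<forall>y\<in>S. f differentiable (at y)) \<and> (\<forall>v. Ck_on k S (\<lambda>y. frechet_derivative f (at y) v))"

text \<open>Meant for open sets in finite-dimensional spaces, where directional derivatives suffice.\<close>

definition smooth_on :: "'b::real_normed_vector set \<Rightarrow> ('b \<Rightarrow> 'c::real_normed_vector) \<Rightarrow> bool" where
  "smooth_on S f \<longleftrightarrow> (\<forall>k. Ck_on k S f)"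

type_synonym ('a, 'b) chart = "'a set \<times> ('a \<Rightarrow> 'b)"

text \<open>The function in a chart \<open>(U, \<phi>)\<close> is relevant on \<open>U\<close> only. The model space is an arbitrary
  finite-dimensional normed space; the class \<open>euclidean_space\<close> would exclude dimension 0.\<close>

definition smooth_atlas :: "('a::topological_space, 'b::real_normed_vector) chart set \<Rightarrow> bool" where
  "smooth_atlas A \<longleftrightarrow>
     (\<exists>B::'b set. finite B \<and> span B = UNIV) \<and>
     (\<Union>(U, \<phi>)\<in>A. U) = UNIV \<and>
     (\<forall>(U, \<phi>)\<in>A. open U \<and> open (\<phi> ` U) \<and> (\<exists>\<psi>. homeomorphism U (\<phi> ` U) \<phi> \<psi>)) \<and>
     (\<forall>(U, \<phi>)\<in>A. \<forall>(V, \<psi>)\<in>A. smooth_on (\<phi> ` (U \<inter> V)) (\<psi> \<circ> inv_into U \<phi>))"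

text \<open>A tensor field of type (0,2) is given by its coordinate expressions: \<open>g (U, \<phi>) p\<close> is the
  inner product on the tangent space at \<open>p \<in> U\<close>, which the chart identifies with the model space.\<close>

definition riemannian_metric ::
  "('a::topological_space, 'b::real_normed_vector) chart set
     \<Rightarrow> (('a, 'b) chart \<Rightarrow> 'a \<Rightarrow> 'b \<Rightarrow> 'b \<Rightarrow> real) \<Rightarrow> bool" where
  "riemannian_metric A g \<longleftrightarrow>
     (\<forall>(U, \<phi>)\<in>A. \<forall>p\<in>U.
        bilinear (g (U, \<phi>) p) \<and>
        (\<forall>v w. g (U, \<phi>) p v w = g (U, \<phi>) p w v) \<and>
        (\<forall>v. v \<noteq> 0 \<longrightarrow> g (U, \<phi>) p v v > 0)) \<and>
     (\<forall>(U, \<phi>)\<in>A. \<forall>v w. smooth_on (\<phi> ` U) (\<lambda>y. g (U, \<phi>) (inv_into U \<phi> y) v w)) \<and>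
     (\<forall>(U, \<phi>)\<in>A. \<forall>(V, \<psi>)\<in>A. \<forall>p \<in> U \<inter> V. \<forall>v w.
        (let D = frechet_derivative (\<psi> \<circ> inv_into U \<phi>) (at (\<phi> p))
         in g (U, \<phi>) p v w = g (V, \<psi>) p (D v) (D w)))"

definition piecewise_C1_curve ::
  "('a::topological_space, 'b::real_normed_vector) chart set \<Rightarrow> (real \<Rightarrow> 'a) \<Rightarrow> bool" where
  "piecewise_C1_curve A \<gamma> \<longleftrightarrow>
     continuous_on {0..1} \<gamma> \<and>
     (\<forall>(U, \<phi>)\<in>A. \<forall>a b. 0 \<le> a \<longrightarrow> b \<le> 1 \<longrightarrow> \<gamma> ` {a..b} \<subseteq> U \<longrightarrow>
        (\<phi> \<circ> \<gamma>) piecewise_C1_differentiable_on {a..b})"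

text \<open>By the transformation rule in \<^const>\<open>riemannian_metric\<close>, the speed does not depend on the
  chart selected at time \<open>t\<close>, except at the finitely many \<open>t\<close> where the curve is not
  differentiable.\<close>

definition curve_speed ::
  "('a::topological_space, 'b::real_normed_vector) chart set
     \<Rightarrow> (('a, 'b) chart \<Rightarrow> 'a \<Rightarrow> 'b \<Rightarrow> 'b \<Rightarrow> real) \<Rightarrow> (real \<Rightarrow> 'a) \<Rightarrow> real \<Rightarrow> real" where
  "curve_speed A g \<gamma> t =
     (let c = (SOME c. c \<in> A \<and> \<gamma> t \<in> fst c);
          v = vector_derivative (snd c \<circ> \<gamma>) (at t)
      in sqrt (g c (\<gamma> t) v v))"

definition curve_length ::
  "('a::topological_space, 'b::real_normed_vector) chart set
     \<Rightarrow> (('a, 'b) chart \<Rightarrow> 'a \<Rightarrow> 'b \<Rightarrow> 'b \<Rightarrow> real) \<Rightarrow> (real \<Rightarrow> 'a) \<Rightarrow> ennreal" where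
  "curve_length A g \<gamma> = (\<integral>\<^sup>+t\<in>{0..1}. ennreal (curve_speed A g \<gamma> t) \<partial>lborel)"

definition riemannian_distance ::
  "('a::topological_space, 'b::real_normed_vector) chart set
     \<Rightarrow> (('a, 'b) chart \<Rightarrow> 'a \<Rightarrow> 'b \<Rightarrow> 'b \<Rightarrow> real) \<Rightarrow> 'a \<Rightarrow> 'a \<Rightarrow> ennreal" where
  "riemannian_distance A g x y =
     (INF \<gamma>\<in>{\<gamma>. piecewise_C1_curve A \<gamma> \<and> \<gamma> 0 = x \<and> \<gamma> 1 = y}. curve_length A g \<gamma>)"

text \<open>The manifold is the whole type \<open>'a\<close>, and \<open>dist\<close> is its Riemannian distance. The class
  constraints supply the Hausdorff property and second countability.\<close>

locale complete_connected_riemannian_manifold =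
  fixes A :: "('a::{metric_space, second_countable_topology}, 'b::real_normed_vector) chart set"
    and g :: "('a, 'b) chart \<Rightarrow> 'a \<Rightarrow> 'b \<Rightarrow> 'b \<Rightarrow> real"
  assumes atlas: "smooth_atlas A"
    and metric: "riemannian_metric A g"
    and dist: "\<And>x y. ennreal (dist x y) = riemannian_distance A g x y"
    and connected: "connected (UNIV :: 'a set)"
    and complete: "uniform_space_class.complete (UNIV :: 'a set)"


section \<open>Transport cost and relative entropy\<close>

definition couplings :: "'a measure \<Rightarrow> 'b measure \<Rightarrow> ('a \<times> 'b) measure set" where
  "couplings \<mu> \<nu> =
     {\<pi>. sets \<pi> = sets (\<mu> \<Otimes>\<^sub>M \<nu>) \<and> distr \<pi> \<mu> fst = \<mu> \<and> distr \<pi> \<nu> snd = \<nu>}"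

definition wasserstein1 :: "('a \<Rightarrow> 'a \<Rightarrow> real) \<Rightarrow> 'a measure \<Rightarrow> 'a measure \<Rightarrow> ennreal" where
  "wasserstein1 c \<mu> \<nu> = (INF \<pi>\<in>couplings \<mu> \<nu>. \<integral>\<^sup>+z. ennreal (c (fst z) (snd z)) \<partial>\<pi>)"

text \<open>\<open>H(\<nu>/\<mu>)\<close> for probability measures on the same space. The negative part of
  \<open>log (d\<nu>/d\<mu>)\<close> is always \<open>\<nu>\<close>-integrable (\<open>t log t \<ge> -1/e\<close>), so that failure of integrability
  means that the integral is \<open>+\<infinity>\<close>; and \<open>KL_divergence\<close> is nonnegative, so that \<open>ennreal\<close> does not
  truncate it.\<close>

definition relative_entropy :: "'a measure \<Rightarrow> 'a measure \<Rightarrow> ennreal" where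
  "relative_entropy \<nu> \<mu> =
     (if absolutely_continuous \<mu> \<nu> \<and> integrable \<nu> (entropy_density (exp 1) \<mu> \<nu>)
      then ennreal (KL_divergence (exp 1) \<mu> \<nu>) else \<infinity>)"

definition ennreal_sqrt :: "ennreal \<Rightarrow> ennreal" where
  "ennreal_sqrt a = (if a = \<infinity> then \<infinity> else ennreal (sqrt (enn2real a)))"


section \<open>The random dynamical system\<close>

text \<open>\<open>E\<^sup>n\<close> is the set of extensional functions on \<open>{1..n}\<close>.\<close>

abbreviation path_space :: "nat \<Rightarrow> (nat \<Rightarrow> 'a::topological_space) measure" where
  "path_space n \<equiv> \<Pi>\<^sub>M i\<in>{1..n}. borel"

definition dist_l1 :: "nat \<Rightarrow> (nat \<Rightarrow> 'a::metric_space) \<Rightarrow> (nat \<Rightarrow> 'a) \<Rightarrow> real" where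
  "dist_l1 n x y = (\<Sum>i=1..n. dist (x i) (y i))"

primrec rds :: "('a \<Rightarrow> 'g \<Rightarrow> 'a) \<Rightarrow> (nat \<Rightarrow> 'w \<Rightarrow> 'g) \<Rightarrow> nat \<Rightarrow> 'a \<Rightarrow> 'w \<Rightarrow> 'a" where
  "rds F W 0 x \<omega> = x"
| "rds F W (Suc n) x \<omega> = F (rds F W n x \<omega>) (W (Suc n) \<omega>)"

definition path_law ::
  "'w measure \<Rightarrow> ('a::topological_space \<Rightarrow> 'g \<Rightarrow> 'a) \<Rightarrow> (nat \<Rightarrow> 'w \<Rightarrow> 'g) \<Rightarrow> nat \<Rightarrow> 'a
     \<Rightarrow> (nat \<Rightarrow> 'a) measure" where
  "path_law M F W n x = distr M (path_space n) (\<lambda>\<omega>. \<lambda>k\<in>{1..n}. rds F W k x \<omega>)"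

end

theory Submission
  imports Defs
begin

text \<open>
  Couple the noise instead of the paths. If \<open>Q\<close> has density \<open>f\<close> with respect to the path law, then
  \<open>Q\<close> is the image of the density \<open>h = f \<circ> \<Phi>\<close> with respect to the law of the noise, where \<open>\<Phi>\<close> maps noise
  to paths, and the entropy is unchanged. A coupling of \<open>h\<close> and the noise law is built
  coordinate by coordinate: given the past, the next coordinates are drawn from the maximal
  coupling of the conditional density \<open>\<rho>\<close> with the reference law, which is explicit, so that neither
  gluing nor duality nor disintegration of measures is needed.

  The extra cost of one step is at most \<open>\<integral>\<integral> d(F(x,u), F(x,v)) \<bar>\<rho>(u) - 1\<bar>\<close>, which a pointwise form of the
  entropy inequality bounds by \<open>Ent(\<rho>)/\<lambda> + \<lambda>c\<close> for every \<open>\<lambda> > 0\<close>. Its effect on later steps is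
  controlled by \<open>V(x,y) = d(x,y) + \<Sum> E d(X\<^sub>k(x), X\<^sub>k(y)) \<le> L d(x,y)\<close>: under synchronous noise \<open>V\<close>
  decreases in expectation by \<open>d\<close>, so that \<open>\<Sum>\<^sub>j\<^sub><\<^sub>k d(X\<^sub>j, X\<^sub>j') + V(X\<^sub>k, X\<^sub>k')\<close> grows by the one-step cost only.
  Summing with the chain rule for the entropy gives \<open>L (H/\<lambda> + n\<lambda>c)\<close>; then optimise over \<open>\<lambda>\<close>.
\<close>

section \<open>Weighted deviation and entropy\<close>

lemma ennreal_cancel_right: "a + ennreal c = b + ennreal c \<Longrightarrow> a = b"
  by (metis add.commute ennreal_add_left_cancel ennreal_neq_top infinity_ennreal_def)

text \<open>The term \<open>1 - t\<close> has integral zero when \<open>t\<close> is a probability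
  density, so this integrates like \<open>t * ln t\<close> but is nonnegative pointwise. Entropies
  become nonnegative integrals, meaningful without integrability conditions. The value at 0 is
  1.\<close>

definition ent_fun :: "real \<Rightarrow> real" where
  "ent_fun t = t * ln t - t + 1"

lemma ent_fun_measurable [measurable]: "ent_fun \<in> borel_measurable borel"
  unfolding ent_fun_def by measurable

text \<open>Convex duality between \<open>ent_fun\<close> and \<open>exp s - 1\<close>: it is
  \<open>1 + z \<le> exp z\<close> at \<open>z = s - ln t\<close>, multiplied by
  \<open>t\<close>.\<close>

lemma ent_fun_young:
  assumes "t \<ge> 0"
  shows "t * s \<le> ent_fun t + exp s - 1"
proof (cases "t = 0")
  case False
  with assms have t: "t > 0" by simp
  have "t * (1 + (s - ln t)) \<le> t * exp (s - ln t)"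
    using exp_ge_add_one_self[of "s - ln t"] t by (intro mult_left_mono) auto
  also have "\<dots> = exp s" using t by (simp add: exp_diff)
  finally show ?thesis by (simp add: ent_fun_def algebra_simps)
qed (simp add: ent_fun_def)

lemma ent_fun_nonneg: "t \<ge> 0 \<Longrightarrow> ent_fun t \<ge> 0"
  using ent_fun_young[of t 0] by simp

text \<open>The error is linear in \<open>lam\<close>, so that one \<open>lam\<close> can be
  optimised later for all steps at once, and it contains only quantities with bounded integrals: the
  density \<open>t\<close> and the exponential moment. For small \<open>lam\<close> the duality is
  expanded to second order; for large \<open>lam\<close> the crude bound \<open>D * (t + 1)\<close>
  suffices.\<close>

lemma weighted_deviation_le:
  fixes D t lam del :: real
  assumes D: "D \<ge> 0" and t: "t \<ge> 0" and lam: "lam > 0" and del: "del > 0"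
  shows "D * \<bar>t - 1\<bar> \<le> ent_fun t / lam + lam / del * (t + 4 * exp (del * D\<^sup>2))"
proof (cases "lam\<^sup>2 \<le> del")
  case True
  define s where "s = lam * D"
  have s: "s \<ge> 0" using D lam by (simp add: s_def)
  have e1: "exp s - 1 \<le> s * exp s"
  proof -
    have "(1 - s) * exp s \<le> exp (-s) * exp s"
      using exp_ge_add_one_self[of "-s"] by (intro mult_right_mono) auto
    then show ?thesis by (simp add: exp_minus algebra_simps)
  qed
  have e2: "exp s - 1 - s \<le> s\<^sup>2 * exp s"
  proof -
    have "exp s - 1 - s \<le> s * (exp s - 1)" using e1 by (simp add: algebra_simps)
    also have "\<dots> \<le> s * (s * exp s)" using e1 s by (intro mult_left_mono) auto
    finally show ?thesis by (simp add: power2_eq_square)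
  qed
  have e3: "exp (-s) - 1 + s \<le> s\<^sup>2 * exp s"
  proof -
    have "exp (-s) \<le> 1 / (1 + s)"
      using exp_ge_add_one_self[of s] s by (simp add: exp_minus field_simps)
    also have "\<dots> \<le> 1 - s + s\<^sup>2"
      using s by (simp add: field_simps power2_eq_square power3_eq_cube)
    finally have "exp (-s) - 1 + s \<le> s\<^sup>2 * 1" by simp
    also have "\<dots> \<le> s\<^sup>2 * exp s" using s by (intro mult_left_mono) auto
    finally show ?thesis .
  qed
  \<comment> \<open>Duality at \<open>s\<close> serves \<open>t \<ge> 1\<close>, duality at
    \<open>-s\<close> serves \<open>t < 1\<close>; in both cases the first-order term cancels and
    the quadratic remainder is left.\<close>
  have "s * \<bar>t - 1\<bar> \<le> ent_fun t + s\<^sup>2 * exp s"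
    using ent_fun_young[OF t, of s] ent_fun_young[OF t, of "-s"] e2 e3
    by (cases "t \<ge> 1") (auto simp: algebra_simps)
  then have "s * \<bar>t - 1\<bar> / lam \<le> (ent_fun t + s\<^sup>2 * exp s) / lam"
    using lam by (intro divide_right_mono) auto
  then have 1: "D * \<bar>t - 1\<bar> \<le> ent_fun t / lam + lam * (D\<^sup>2 * exp s)"
    using lam by (simp add: s_def field_simps power2_eq_square)
  \<comment> \<open>Here \<open>lam\<^sup>2 \<le> del\<close> enters: \<open>exp s\<close> costs
    only half of the exponential moment, and the other half absorbs
    \<open>D\<^sup>2\<close>.\<close>
  have sle: "s \<le> 1 / 2 + del * D\<^sup>2 / 2"
  proof -
    have "2 * s \<le> lam\<^sup>2 / del + del * D\<^sup>2"
    proof -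
      have "0 \<le> (lam - del * D)\<^sup>2 / del" using del by simp
      also have "\<dots> = lam\<^sup>2 / del + del * D\<^sup>2 - 2 * s"
        using del by (simp add: s_def power2_diff field_simps power2_eq_square)
      finally show ?thesis by simp
    qed
    also have "lam\<^sup>2 / del \<le> 1" using True del by simp
    finally show ?thesis by simp
  qed
  have "del * D\<^sup>2 / 2 \<le> exp (del * D\<^sup>2 / 2)"
    using exp_ge_add_one_self[of "del * D\<^sup>2 / 2"] by linarith
  then have d2: "D\<^sup>2 \<le> 2 / del * exp (del * D\<^sup>2 / 2)" using del by (simp add: field_simps)
  have half: "exp (1/2::real) \<le> 2"
    using exp_half_le2 by simp
  have "D\<^sup>2 * exp s \<le> (2 / del * exp (del * D\<^sup>2 / 2)) * exp (1 / 2 + del * D\<^sup>2 / 2)"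
    using d2 sle del by (intro mult_mono) auto
  also have "\<dots> = 2 / del * exp (1/2) * exp (del * D\<^sup>2)"
    by (simp add: exp_add[symmetric])
  also have "\<dots> \<le> 2 / del * 2 * exp (del * D\<^sup>2)"
    using half del by (intro mult_right_mono mult_left_mono) auto
  finally have "lam * (D\<^sup>2 * exp s) \<le> lam * (4 / del * exp (del * D\<^sup>2))"
    using lam by (intro mult_left_mono) auto
  also have "\<dots> \<le> lam / del * (t + 4 * exp (del * D\<^sup>2))"
    using t lam del by (simp add: field_simps)
  finally show ?thesis using 1 by simp
next
  case False
  then have inv: "1 / lam \<le> lam / del" using lam del by (simp add: field_simps power2_eq_square)
  define e where "e = exp (del * D\<^sup>2)"
  \<comment> \<open>This replaces the weight \<open>D\<close> by a multiple of
    \<open>del * D\<^sup>2\<close>, at which the duality produces exactly the exponential moment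
    \<open>e\<close>.\<close>
  have D_le: "D \<le> (del * D\<^sup>2) / lam + lam / del / 4"
  proof -
    have "0 \<le> (2 * del * D - lam)\<^sup>2 / (4 * del * lam)" using del lam by simp
    also have "\<dots> = del * D\<^sup>2 / lam + lam / del / 4 - D"
      using del lam by (simp add: power2_diff field_simps power2_eq_square)
    finally show ?thesis by simp
  qed
  have d_le: "del * D\<^sup>2 \<le> e" 
    using exp_ge_add_one_self[of "del * D\<^sup>2"] unfolding e_def by linarith
  have e0: "e > 0" "e \<ge> 1" using del by (auto simp: e_def)
  have "D * t \<le> ((del * D\<^sup>2) / lam + lam / del / 4) * t"
    using D_le t by (intro mult_right_mono)
  also have "\<dots> = (t * (del * D\<^sup>2)) / lam + lam / del * t / 4" by (simp add: algebra_simps)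
  also have "\<dots> \<le> (ent_fun t + e) / lam + lam / del * t / 4"
    using ent_fun_young[OF t, of "del * D\<^sup>2"] lam unfolding e_def[symmetric]
    by (intro add_mono divide_right_mono) auto
  finally have a: "D * t \<le> ent_fun t / lam + 1 / lam * e + lam / del * t / 4"
    by (simp add: add_divide_distrib)
  have "D \<le> e / lam + lam / del / 4"
    using D_le divide_right_mono[OF d_le, of lam] lam by simp
  then have b: "D \<le> 1 / lam * e + lam / del / 4" by simp
  have c: "1 / lam * e \<le> lam / del * e" using inv e0 by (intro mult_right_mono) auto
  have w: "0 \<le> lam / del" using lam del by simp
  have l: "lam / del \<le> lam / del * e" using mult_left_mono[OF e0(2) w] by simp
  \<comment> \<open>The remaining estimate is linear in the products, which are therefore replaced
    by variables.\<close>
  have combine: "x + y \<le> A + p + 4 * q"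
    if "x \<le> A + k + p / 4" "y \<le> k + w / 4" "k \<le> q" "w \<le> q" "0 \<le> w" "0 \<le> p" for x y A k p q w :: real
    using that by linarith
  have "D * \<bar>t - 1\<bar> \<le> D * (t + 1)" using D t by (intro mult_left_mono) auto
  also have "\<dots> = D * t + D" by (simp add: algebra_simps)
  also have "\<dots> \<le> ent_fun t / lam + lam / del * t + 4 * (lam / del * e)"
    by (rule combine[OF a b c l w mult_nonneg_nonneg[OF w t]])
  also have "\<dots> = ent_fun t / lam + lam / del * (t + 4 * e)" by (simp add: algebra_simps)
  finally show ?thesis unfolding e_def .
qed

section \<open>The maximal coupling with a reference measure\<close>

text \<open>The coupling is given by its integral functional. If the normalising integral vanishes, then
  \<open>\<rho> = 1\<close> almost everywhere and the value of the quotient is irrelevant.\<close>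

definition maximal_coupling :: "'g measure \<Rightarrow> ('g \<Rightarrow> real) \<Rightarrow> ('g \<times> 'g \<Rightarrow> ennreal) \<Rightarrow> ennreal" where
  "maximal_coupling \<gamma> \<rho> f =
     (\<integral>\<^sup>+u. ennreal (min (\<rho> u) 1) * f (u, u) \<partial>\<gamma>) +
     (\<integral>\<^sup>+u. \<integral>\<^sup>+v. ennreal (\<rho> u - 1) * ennreal (1 - \<rho> v) / (\<integral>\<^sup>+z. ennreal (1 - \<rho> z) \<partial>\<gamma>) * f (u, v) \<partial>\<gamma> \<partial>\<gamma>)"

context prob_space
begin

text \<open>As \<open>ennreal\<close> truncates at 0, these are the masses of the positive and
  negative parts of \<open>\<rho> - 1\<close>. Writing
  \<open>\<rho> + (1 - \<rho>)\<^sup>+ = 1 + (\<rho> - 1)\<^sup>+\<close> avoids subtraction, and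
  the mass 1 cancels.\<close>

lemma excess_eq_deficit:
  assumes [measurable]: "\<rho> \<in> borel_measurable M" and nn: "\<And>u. 0 \<le> \<rho> u"
    and one: "(\<integral>\<^sup>+u. ennreal (\<rho> u) \<partial>M) = 1"
  shows "(\<integral>\<^sup>+u. ennreal (\<rho> u - 1) \<partial>M) = (\<integral>\<^sup>+u. ennreal (1 - \<rho> u) \<partial>M)"
proof -
  have "(\<integral>\<^sup>+u. ennreal (\<rho> u) + ennreal (1 - \<rho> u) \<partial>M) = (\<integral>\<^sup>+u. 1 + ennreal (\<rho> u - 1) \<partial>M)"
  proof (rule nn_integral_cong)
    fix u show "ennreal (\<rho> u) + ennreal (1 - \<rho> u) = 1 + ennreal (\<rho> u - 1)"
    proof (cases "\<rho> u \<le> 1")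
      case True
      then have "ennreal (\<rho> u) + ennreal (1 - \<rho> u) = ennreal 1"
        using nn[of u] by (subst ennreal_plus[symmetric]) auto
      then show ?thesis using True by (simp add: ennreal_neg)
    next
      case False
      then have "ennreal 1 + ennreal (\<rho> u - 1) = ennreal (\<rho> u)"
        by (subst ennreal_plus[symmetric]) auto
      then show ?thesis using False by (simp add: ennreal_neg)
    qed
  qed
  then have "1 + (\<integral>\<^sup>+u. ennreal (1 - \<rho> u) \<partial>M) = 1 + (\<integral>\<^sup>+u. ennreal (\<rho> u - 1) \<partial>M)"
    using one by (simp add: nn_integral_add emeasure_space_1)
  then show ?thesis by (simp add: ennreal_add_left_cancel)
qed

lemma deficit_finite:
  assumes nn: "\<And>u. 0 \<le> \<rho> u"
  shows "(\<integral>\<^sup>+u. ennreal (1 - \<rho> u) \<partial>M) \<noteq> \<top>"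
proof -
  have "(\<integral>\<^sup>+u. ennreal (1 - \<rho> u) \<partial>M) \<le> (\<integral>\<^sup>+u. 1 \<partial>M)"
    using nn by (intro nn_integral_mono) (auto simp: ennreal_le_1)
  also have "\<dots> = 1" by (simp add: emeasure_space_1)
  finally show ?thesis by (auto simp: top_unique)
qed

text \<open>Integrating out \<open>v\<close> produces the factor \<open>m / m\<close>. It is not 1
  when \<open>m = 0\<close>, but then the excess vanishes almost everywhere and both sides are
  0.\<close>

lemma excess_fst:
  assumes [measurable]: "\<rho> \<in> borel_measurable M" and nn: "\<And>u. 0 \<le> \<rho> u"
    and one: "(\<integral>\<^sup>+u. ennreal (\<rho> u) \<partial>M) = 1" and [measurable]: "f \<in> borel_measurable M"
  shows "(\<integral>\<^sup>+u. \<integral>\<^sup>+v. ennreal (\<rho> u - 1) * ennreal (1 - \<rho> v) / (\<integral>\<^sup>+z. ennreal (1 - \<rho> z) \<partial>M) * f u \<partial>M \<partial>M)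
    = (\<integral>\<^sup>+u. ennreal (\<rho> u - 1) * f u \<partial>M)"
proof -
  define m where "m = (\<integral>\<^sup>+z. ennreal (1 - \<rho> z) \<partial>M)"
  have fin: "m \<noteq> \<top>" unfolding m_def by (rule deficit_finite[OF nn])
  have "(\<integral>\<^sup>+v. ennreal (\<rho> u - 1) * ennreal (1 - \<rho> v) / m * f u \<partial>M) = ennreal (\<rho> u - 1) * f u * (m / m)" for u
  proof -
    have "(\<integral>\<^sup>+v. ennreal (\<rho> u - 1) * ennreal (1 - \<rho> v) / m * f u \<partial>M)
      = (\<integral>\<^sup>+v. (ennreal (\<rho> u - 1) * f u * inverse m) * ennreal (1 - \<rho> v) \<partial>M)"
      by (intro nn_integral_cong) (simp add: divide_ennreal_def mult_ac)
    also have "\<dots> = (ennreal (\<rho> u - 1) * f u * inverse m) * m"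
      by (simp add: nn_integral_cmult m_def)
    finally show ?thesis by (simp add: divide_ennreal_def mult_ac)
  qed
  then have *: "(\<integral>\<^sup>+u. \<integral>\<^sup>+v. ennreal (\<rho> u - 1) * ennreal (1 - \<rho> v) / m * f u \<partial>M \<partial>M)
     = (\<integral>\<^sup>+u. ennreal (\<rho> u - 1) * f u * (m / m) \<partial>M)" by simp
  show ?thesis
  proof (cases "m = 0")
    case True
    then have "(\<integral>\<^sup>+u. ennreal (\<rho> u - 1) \<partial>M) = 0"
      using excess_eq_deficit[OF assms(1) nn one] by (simp add: m_def)
    then have "AE u in M. ennreal (\<rho> u - 1) = 0" by (subst (asm) nn_integral_0_iff_AE) auto
    then have "AE u in M. ennreal (\<rho> u - 1) * f u * (m / m) = ennreal (\<rho> u - 1) * f u"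
      by eventually_elim auto
    then show ?thesis using * unfolding m_def by (simp cong: nn_integral_cong_AE)
  next
    case False
    then have "m / m = 1" using fin by (simp add: ennreal_divide_self top.not_eq_extremum)
    then show ?thesis using * unfolding m_def by simp
  qed
qed

text \<open>Integrating out \<open>u\<close> produces the mass of the excess, which equals
  \<open>m\<close> and cancels the normalisation; for \<open>m = 0\<close> both sides
  vanish.\<close>

lemma excess_snd:
  assumes [measurable]: "\<rho> \<in> borel_measurable M" and nn: "\<And>u. 0 \<le> \<rho> u"
    and one: "(\<integral>\<^sup>+u. ennreal (\<rho> u) \<partial>M) = 1" and [measurable]: "f \<in> borel_measurable M"
  shows "(\<integral>\<^sup>+u. \<integral>\<^sup>+v. ennreal (\<rho> u - 1) * ennreal (1 - \<rho> v) / (\<integral>\<^sup>+z. ennreal (1 - \<rho> z) \<partial>M) * f v \<partial>M \<partial>M)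
    = (\<integral>\<^sup>+v. ennreal (1 - \<rho> v) * f v \<partial>M)"
proof -
  define m where "m = (\<integral>\<^sup>+z. ennreal (1 - \<rho> z) \<partial>M)"
  have fin: "m \<noteq> \<top>" unfolding m_def by (rule deficit_finite[OF nn])
  define I where "I = (\<integral>\<^sup>+v. ennreal (1 - \<rho> v) * f v \<partial>M)"
  have "(\<integral>\<^sup>+v. ennreal (\<rho> u - 1) * ennreal (1 - \<rho> v) / m * f v \<partial>M) = I * inverse m * ennreal (\<rho> u - 1)" for u
  proof -
    have "(\<integral>\<^sup>+v. ennreal (\<rho> u - 1) * ennreal (1 - \<rho> v) / m * f v \<partial>M)
      = (\<integral>\<^sup>+v. (ennreal (\<rho> u - 1) * inverse m) * (ennreal (1 - \<rho> v) * f v) \<partial>M)"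
      by (intro nn_integral_cong) (simp add: divide_ennreal_def mult_ac)
    also have "\<dots> = (ennreal (\<rho> u - 1) * inverse m) * I"
      unfolding I_def by (rule nn_integral_cmult) auto
    finally show ?thesis by (simp add: mult_ac)
  qed
  then have *: "(\<integral>\<^sup>+u. \<integral>\<^sup>+v. ennreal (\<rho> u - 1) * ennreal (1 - \<rho> v) / m * f v \<partial>M \<partial>M)
     = I * (m / m)"
    using excess_eq_deficit[OF assms(1) nn one]
    by (simp add: nn_integral_cmult divide_ennreal_def mult_ac flip: m_def)
  show ?thesis
  proof (cases "m = 0")
    case True
    then have "AE v in M. ennreal (1 - \<rho> v) = 0"
      unfolding m_def by (subst (asm) nn_integral_0_iff_AE) auto
    then have "AE v in M. ennreal (1 - \<rho> v) * f v = 0"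
      by eventually_elim auto
    then have "I = 0" unfolding I_def by (subst nn_integral_0_iff_AE) auto
    then show ?thesis using * unfolding m_def I_def by simp
  next
    case False
    then have "m / m = 1" using fin by (simp add: ennreal_divide_self top.not_eq_extremum)
    then show ?thesis using * unfolding m_def I_def by simp
  qed
qed

text \<open>The diagonal part and the excess add up to the density:
  \<open>min \<rho> 1 + (\<rho> - 1)\<^sup>+ = \<rho>\<close>.\<close>

lemma maximal_coupling_fst:
  assumes [measurable]: "\<rho> \<in> borel_measurable M" and nn: "\<And>u. 0 \<le> \<rho> u"
    and one: "(\<integral>\<^sup>+u. ennreal (\<rho> u) \<partial>M) = 1" and [measurable]: "f \<in> borel_measurable M"
  shows "maximal_coupling M \<rho> (\<lambda>(u, v). f u) = (\<integral>\<^sup>+u. ennreal (\<rho> u) * f u \<partial>M)"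
proof -
  have "ennreal (min (\<rho> u) 1) + ennreal (\<rho> u - 1) = ennreal (\<rho> u)" for u
  proof (cases "\<rho> u \<le> 1")
    case False
    then have "ennreal 1 + ennreal (\<rho> u - 1) = ennreal (\<rho> u)"
      by (subst ennreal_plus[symmetric]) auto
    then show ?thesis using False by (simp add: min_def)
  qed (simp add: ennreal_neg)
  then have "(\<integral>\<^sup>+u. ennreal (min (\<rho> u) 1) * f u + ennreal (\<rho> u - 1) * f u \<partial>M) = (\<integral>\<^sup>+u. ennreal (\<rho> u) * f u \<partial>M)"
    by (intro nn_integral_cong) (metis distrib_right)
  then show ?thesis
    unfolding maximal_coupling_def by (simp add: excess_fst nn one nn_integral_add)
qed

text \<open>The diagonal part and the deficit add up to 1, so the second coordinate has the
  reference law whatever \<open>\<rho>\<close> is.\<close>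

lemma maximal_coupling_snd:
  assumes [measurable]: "\<rho> \<in> borel_measurable M" and nn: "\<And>u. 0 \<le> \<rho> u"
    and one: "(\<integral>\<^sup>+u. ennreal (\<rho> u) \<partial>M) = 1" and [measurable]: "f \<in> borel_measurable M"
  shows "maximal_coupling M \<rho> (\<lambda>(u, v). f v) = (\<integral>\<^sup>+v. f v \<partial>M)"
proof -
  have "ennreal (min (\<rho> u) 1) + ennreal (1 - \<rho> u) = 1" for u
    using nn[of u] by (cases "\<rho> u \<le> 1") (auto simp: ennreal_neg min_def ennreal_plus[symmetric] simp del: ennreal_plus)
  then have "(\<integral>\<^sup>+u. ennreal (min (\<rho> u) 1) * f u + ennreal (1 - \<rho> u) * f u \<partial>M) = (\<integral>\<^sup>+u. f u \<partial>M)"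
    by (intro nn_integral_cong) (metis distrib_right mult_1)
  then show ?thesis
    unfolding maximal_coupling_def by (simp add: excess_snd nn one nn_integral_add)
qed

text \<open>The diagonal costs nothing. On the product part a third point \<open>z\<close> with the
  reference law is inserted between \<open>u\<close> and \<open>v\<close>; this separates the
  variables and leaves the integral of \<open>D u z * \<bar>\<rho> u - 1\<bar>\<close>, to which the
  pointwise entropy inequality applies.\<close>

lemma maximal_coupling_cost:
  fixes D :: "'a \<Rightarrow> 'a \<Rightarrow> real" and lam del K :: real
  assumes [measurable]: "\<rho> \<in> borel_measurable M" and nn: "\<And>u. 0 \<le> \<rho> u"
    and one: "(\<integral>\<^sup>+u. ennreal (\<rho> u) \<partial>M) = 1"
    and D_meas [measurable]: "(\<lambda>(u, v). D u v) \<in> borel_measurable (M \<Otimes>\<^sub>M M)"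
    and D_nn: "\<And>u v. 0 \<le> D u v" and D_refl: "\<And>u. D u u = 0"
    and D_sym: "\<And>u v. D u v = D v u" and D_tri: "\<And>u v w. D u w \<le> D u v + D v w"
    and lam: "lam > 0" and del: "del > 0" and K: "0 \<le> K"
    and D_exp: "(\<integral>\<^sup>+u. \<integral>\<^sup>+v. ennreal (exp (del * (D u v)\<^sup>2)) \<partial>M \<partial>M) \<le> ennreal K"
  shows "maximal_coupling M \<rho> (\<lambda>(u, v). ennreal (D u v))
    \<le> ennreal (1 / lam) * (\<integral>\<^sup>+u. ennreal (ent_fun (\<rho> u)) \<partial>M) + ennreal (lam * (1 + 4 * K) / del)"
proof -
  define m where "m = (\<integral>\<^sup>+z. ennreal (1 - \<rho> z) \<partial>M)"
  define q where "q u v = ennreal (\<rho> u - 1) * ennreal (1 - \<rho> v) / m" for u v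
  have q_meas [measurable]: "(\<lambda>(u,v). q u v) \<in> borel_measurable (M \<Otimes>\<^sub>M M)" unfolding q_def m_def by measurable
  define \<phi> where "\<phi> u = (\<integral>\<^sup>+z. ennreal (D u z) \<partial>M)" for u
  have \<phi>_meas [measurable]: "\<phi> \<in> borel_measurable M" unfolding \<phi>_def by measurable
  have tri: "ennreal (D u v) \<le> \<phi> u + \<phi> v" if "u \<in> space M" "v \<in> space M" for u v
  proof -
    note [measurable] = measurable_Pair2[OF D_meas that(1), simplified] measurable_Pair2[OF D_meas that(2), simplified]
    have "ennreal (D u v) = (\<integral>\<^sup>+z. ennreal (D u v) \<partial>M)" by (simp add: emeasure_space_1)
    also have "\<dots> \<le> (\<integral>\<^sup>+z. ennreal (D u z) + ennreal (D v z) \<partial>M)"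
      using D_tri[of u v] D_sym[of v] D_nn
      by (intro nn_integral_mono) (auto simp: ennreal_plus[symmetric] simp del: ennreal_plus intro!: ennreal_leI)
    also have "\<dots> = \<phi> u + \<phi> v" unfolding \<phi>_def by (rule nn_integral_add) auto
    finally show ?thesis .
  qed
  have "maximal_coupling M \<rho> (\<lambda>(u, v). ennreal (D u v)) = (\<integral>\<^sup>+u. \<integral>\<^sup>+v. q u v * ennreal (D u v) \<partial>M \<partial>M)"
    unfolding maximal_coupling_def q_def m_def by (simp add: D_refl)
  also have "\<dots> \<le> (\<integral>\<^sup>+u. \<integral>\<^sup>+v. q u v * (\<phi> u + \<phi> v) \<partial>M \<partial>M)"
    by (intro nn_integral_mono mult_left_mono tri) auto
  also have "\<dots> = (\<integral>\<^sup>+u. \<integral>\<^sup>+v. q u v * \<phi> u \<partial>M \<partial>M) + (\<integral>\<^sup>+u. \<integral>\<^sup>+v. q u v * \<phi> v \<partial>M \<partial>M)"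
  proof -
    have "(\<integral>\<^sup>+v. q u v * (\<phi> u + \<phi> v) \<partial>M) = (\<integral>\<^sup>+v. q u v * \<phi> u \<partial>M) + (\<integral>\<^sup>+v. q u v * \<phi> v \<partial>M)"
      if "u \<in> space M" for u
    proof -
      note [measurable] = measurable_Pair2[OF q_meas that(1), simplified]
      show ?thesis by (simp add: distrib_left nn_integral_add)
    qed
    then have "(\<integral>\<^sup>+u. \<integral>\<^sup>+v. q u v * (\<phi> u + \<phi> v) \<partial>M \<partial>M) = (\<integral>\<^sup>+u. (\<integral>\<^sup>+v. q u v * \<phi> u \<partial>M) + (\<integral>\<^sup>+v. q u v * \<phi> v \<partial>M) \<partial>M)"
      by (intro nn_integral_cong) auto
    also have "\<dots> = (\<integral>\<^sup>+u. \<integral>\<^sup>+v. q u v * \<phi> u \<partial>M \<partial>M) + (\<integral>\<^sup>+u. \<integral>\<^sup>+v. q u v * \<phi> v \<partial>M \<partial>M)"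
      by (rule nn_integral_add) measurable
    finally show ?thesis .
  qed
  \<comment> \<open>The excess meets only \<open>\<phi> u\<close> and the deficit only
    \<open>\<phi> v\<close>; together they weight \<open>\<phi>\<close> by
    \<open>\<bar>\<rho> - 1\<bar>\<close>.\<close>
  also have "\<dots> = (\<integral>\<^sup>+u. ennreal (\<rho> u - 1) * \<phi> u \<partial>M) + (\<integral>\<^sup>+u. ennreal (1 - \<rho> u) * \<phi> u \<partial>M)"
    unfolding q_def m_def by (simp only: excess_fst[OF assms(1) nn one \<phi>_meas] excess_snd[OF assms(1) nn one \<phi>_meas])
  also have "\<dots> = (\<integral>\<^sup>+u. ennreal (\<rho> u - 1) * \<phi> u + ennreal (1 - \<rho> u) * \<phi> u \<partial>M)"
    by (simp add: nn_integral_add)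
  also have "\<dots> = (\<integral>\<^sup>+u. ennreal \<bar>\<rho> u - 1\<bar> * \<phi> u \<partial>M)"
    by (intro nn_integral_cong) (auto simp: abs_if ennreal_neg)
  also have "\<dots> = (\<integral>\<^sup>+u. \<integral>\<^sup>+z. ennreal (D u z * \<bar>\<rho> u - 1\<bar>) \<partial>M \<partial>M)"
  proof (rule nn_integral_cong)
    fix u assume u: "u \<in> space M"
    note [measurable] = measurable_Pair2[OF D_meas u, simplified]
    show "ennreal \<bar>\<rho> u - 1\<bar> * \<phi> u = (\<integral>\<^sup>+z. ennreal (D u z * \<bar>\<rho> u - 1\<bar>) \<partial>M)"
      unfolding \<phi>_def by (subst nn_integral_cmult[symmetric]) (auto simp: ennreal_mult' ennreal_mult'' D_nn mult_ac)
  qed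
  \<comment> \<open>The exponential ends up integrated against the untilted product measure, as in
    \<open>D_exp\<close>; \<open>\<rho>\<close> enters only through its entropy and its mass
    1.\<close>
  also have "\<dots> \<le> (\<integral>\<^sup>+u. \<integral>\<^sup>+z. ennreal (1 / lam) * ennreal (ent_fun (\<rho> u)) + (ennreal (lam / del) * ennreal (\<rho> u)
      + ennreal (4 * lam / del) * ennreal (exp (del * (D u z)\<^sup>2))) \<partial>M \<partial>M)"
  proof (intro nn_integral_mono)
    fix u z
    have "ennreal (D u z * \<bar>\<rho> u - 1\<bar>) \<le> ennreal (1 / lam * ent_fun (\<rho> u) + (lam / del * \<rho> u + 4 * lam / del * exp (del * (D u z)\<^sup>2)))"
      using weighted_deviation_le[OF D_nn[of u z] nn[of u] lam del] by (intro ennreal_leI) (simp add: algebra_simps)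
    also have "\<dots> = ennreal (1 / lam) * ennreal (ent_fun (\<rho> u)) + (ennreal (lam / del) * ennreal (\<rho> u)
      + ennreal (4 * lam / del) * ennreal (exp (del * (D u z)\<^sup>2)))"
      using lam del nn[of u] ent_fun_nonneg[OF nn[of u]] by (simp add: ennreal_mult[symmetric] ennreal_plus[symmetric] del: ennreal_plus)
    finally show "ennreal (D u z * \<bar>\<rho> u - 1\<bar>) \<le> \<dots>" .
  qed
  also have "\<dots> = (\<integral>\<^sup>+u. ennreal (1 / lam) * ennreal (ent_fun (\<rho> u)) + (ennreal (lam / del) * ennreal (\<rho> u)
      + ennreal (4 * lam / del) * (\<integral>\<^sup>+z. ennreal (exp (del * (D u z)\<^sup>2)) \<partial>M)) \<partial>M)"
  proof (rule nn_integral_cong)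
    fix u assume u: "u \<in> space M"
    note [measurable] = measurable_Pair2[OF D_meas u, simplified]
    show "(\<integral>\<^sup>+z. ennreal (1 / lam) * ennreal (ent_fun (\<rho> u)) + (ennreal (lam / del) * ennreal (\<rho> u)
      + ennreal (4 * lam / del) * ennreal (exp (del * (D u z)\<^sup>2))) \<partial>M) = ennreal (1 / lam) * ennreal (ent_fun (\<rho> u)) + (ennreal (lam / del) * ennreal (\<rho> u)
      + ennreal (4 * lam / del) * (\<integral>\<^sup>+z. ennreal (exp (del * (D u z)\<^sup>2)) \<partial>M))"
      by (simp add: nn_integral_add nn_integral_cmult emeasure_space_1)
  qed
  also have "\<dots> = ennreal (1 / lam) * (\<integral>\<^sup>+u. ennreal (ent_fun (\<rho> u)) \<partial>M) + (ennreal (lam / del) * (\<integral>\<^sup>+u. ennreal (\<rho> u) \<partial>M)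
      + ennreal (4 * lam / del) * (\<integral>\<^sup>+u. \<integral>\<^sup>+z. ennreal (exp (del * (D u z)\<^sup>2)) \<partial>M \<partial>M))"
    by (simp add: nn_integral_add nn_integral_cmult)
  also have "\<dots> \<le> ennreal (1 / lam) * (\<integral>\<^sup>+u. ennreal (ent_fun (\<rho> u)) \<partial>M) + (ennreal (lam / del) * 1
      + ennreal (4 * lam / del) * ennreal K)"
    using D_exp one by (intro add_mono mult_left_mono) auto
  also have "ennreal (lam / del) * 1 + ennreal (4 * lam / del) * ennreal K = ennreal (lam * (1 + 4 * K) / del)"
    using lam del K by (simp add: ennreal_mult[symmetric] ennreal_plus[symmetric] algebra_simps add_divide_distrib del: ennreal_plus)
  finally show ?thesis .
qed

section \<open>Linearity of the coupling functional and its use as a kernel\<close>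

lemma maximal_coupling_mono:
  assumes "\<And>u v. u \<in> space M \<Longrightarrow> v \<in> space M \<Longrightarrow> f (u, v) \<le> g (u, v)"
  shows "maximal_coupling M \<rho> f \<le> maximal_coupling M \<rho> g"
  unfolding maximal_coupling_def
  by (intro add_mono nn_integral_mono mult_left_mono assms) auto

lemma maximal_coupling_add:
  assumes [measurable]: "\<rho> \<in> borel_measurable M"
    and f [measurable]: "f \<in> borel_measurable (M \<Otimes>\<^sub>M M)" and g [measurable]: "g \<in> borel_measurable (M \<Otimes>\<^sub>M M)"
  shows "maximal_coupling M \<rho> (\<lambda>z. f z + g z) = maximal_coupling M \<rho> f + maximal_coupling M \<rho> g"
proof -
  define m where "m = (\<integral>\<^sup>+z. ennreal (1 - \<rho> z) \<partial>M)"
  define q where "q u v = ennreal (\<rho> u - 1) * ennreal (1 - \<rho> v) / m" for u v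
  have q_meas [measurable]: "(\<lambda>(u,v). q u v) \<in> borel_measurable (M \<Otimes>\<^sub>M M)" unfolding q_def by measurable
  have "(\<integral>\<^sup>+v. q u v * (f (u, v) + g (u, v)) \<partial>M) = (\<integral>\<^sup>+v. q u v * f (u, v) \<partial>M) + (\<integral>\<^sup>+v. q u v * g (u, v) \<partial>M)"
    if u: "u \<in> space M" for u
  proof -
    note [measurable] = measurable_Pair2[OF q_meas u, simplified] measurable_Pair2[OF f u] measurable_Pair2[OF g u]
    show ?thesis by (simp add: distrib_left nn_integral_add)
  qed
  then have "(\<integral>\<^sup>+u. \<integral>\<^sup>+v. q u v * (f (u, v) + g (u, v)) \<partial>M \<partial>M)
    = (\<integral>\<^sup>+u. (\<integral>\<^sup>+v. q u v * f (u, v) \<partial>M) + (\<integral>\<^sup>+v. q u v * g (u, v) \<partial>M) \<partial>M)"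
    by (intro nn_integral_cong) auto
  also have "\<dots> = (\<integral>\<^sup>+u. \<integral>\<^sup>+v. q u v * f (u, v) \<partial>M \<partial>M) + (\<integral>\<^sup>+u. \<integral>\<^sup>+v. q u v * g (u, v) \<partial>M \<partial>M)"
    by (rule nn_integral_add) measurable
  finally show ?thesis
    unfolding maximal_coupling_def m_def[symmetric] q_def[symmetric]
    by (simp add: distrib_left nn_integral_add add_ac)
qed

lemma maximal_coupling_cmult:
  assumes [measurable]: "\<rho> \<in> borel_measurable M" and f [measurable]: "f \<in> borel_measurable (M \<Otimes>\<^sub>M M)"
  shows "maximal_coupling M \<rho> (\<lambda>z. c * f z) = c * maximal_coupling M \<rho> f"
proof -
  define m where "m = (\<integral>\<^sup>+z. ennreal (1 - \<rho> z) \<partial>M)"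
  define q where "q u v = ennreal (\<rho> u - 1) * ennreal (1 - \<rho> v) / m" for u v
  have q_meas [measurable]: "(\<lambda>(u,v). q u v) \<in> borel_measurable (M \<Otimes>\<^sub>M M)" unfolding q_def by measurable
  have "(\<integral>\<^sup>+v. q u v * (c * f (u, v)) \<partial>M) = c * (\<integral>\<^sup>+v. q u v * f (u, v) \<partial>M)"
    if u: "u \<in> space M" for u
  proof -
    note [measurable] = measurable_Pair2[OF q_meas u, simplified] measurable_Pair2[OF f u]
    show ?thesis by (simp add: nn_integral_cmult mult.left_commute)
  qed
  then have "(\<integral>\<^sup>+u. \<integral>\<^sup>+v. q u v * (c * f (u, v)) \<partial>M \<partial>M)
    = (\<integral>\<^sup>+u. c * (\<integral>\<^sup>+v. q u v * f (u, v) \<partial>M) \<partial>M)"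
    by (intro nn_integral_cong) auto
  also have "\<dots> = c * (\<integral>\<^sup>+u. \<integral>\<^sup>+v. q u v * f (u, v) \<partial>M \<partial>M)"
    by (rule nn_integral_cmult) measurable
  finally show ?thesis
    unfolding maximal_coupling_def m_def[symmetric] q_def[symmetric]
    by (simp add: distrib_left nn_integral_cmult mult.left_commute)
qed

text \<open>The coordinate \<open>b\<close> selects between the diagonal and the product part of
  \<^const>\<open>maximal_coupling\<close>, so that a density on a product space describes the whole kernel.\<close>

lemma coupling_extension:
  fixes \<pi> :: "('b \<times> 'b) measure"
  assumes sets_\<pi>: "sets \<pi> = sets (N \<Otimes>\<^sub>M N)"
    and \<rho>_meas [measurable]: "(\<lambda>(w, u). \<rho> w u) \<in> borel_measurable (N \<Otimes>\<^sub>M M)"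
    and T_meas [measurable]: "T \<in> N \<Otimes>\<^sub>M M \<rightarrow>\<^sub>M N'"
  shows "\<exists>\<pi>'. sets \<pi>' = sets (N' \<Otimes>\<^sub>M N') \<and>
    (\<forall>f\<in>borel_measurable (N' \<Otimes>\<^sub>M N'). (\<integral>\<^sup>+z. f z \<partial>\<pi>') =
      (\<integral>\<^sup>+z. maximal_coupling M (\<rho> (fst z)) (\<lambda>(u, v). f (T (fst z, u), T (snd z, v))) \<partial>\<pi>))"
proof -
  note [measurable_cong] = sets_\<pi>
  define m where "m w = (\<integral>\<^sup>+z. ennreal (1 - \<rho> w z) \<partial>M)" for w
  have [measurable]: "m \<in> borel_measurable N" unfolding m_def by measurable
  define R where "R = M \<Otimes>\<^sub>M (M \<Otimes>\<^sub>M count_space (UNIV :: bool set))"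
  define dens :: "('b \<times> 'b) \<times> 'a \<times> 'a \<times> bool \<Rightarrow> ennreal" where
    "dens = (\<lambda>(z, u, v, b). if b then ennreal (\<rho> (fst z) u - 1) * ennreal (1 - \<rho> (fst z) v) / m (fst z)
                                  else ennreal (min (\<rho> (fst z) u) 1))"
  \<comment> \<open>For \<open>b = False\<close> the coordinate \<open>u\<close> is used twice,
    which realises the diagonal, and \<open>v\<close> integrates to 1.\<close>
  define place :: "('b \<times> 'b) \<times> 'a \<times> 'a \<times> bool \<Rightarrow> _" where "place = (\<lambda>(z, u, v, b). (T (fst z, u), T (snd z, if b then v else u)))"
  have [measurable]: "dens \<in> borel_measurable (\<pi> \<Otimes>\<^sub>M R)" unfolding dens_def R_def by measurable
  have [measurable]: "place \<in> \<pi> \<Otimes>\<^sub>M R \<rightarrow>\<^sub>M N' \<Otimes>\<^sub>M N'" unfolding place_def R_def by measurable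
  define \<pi>' where "\<pi>' = distr (density (\<pi> \<Otimes>\<^sub>M R) dens) (N' \<Otimes>\<^sub>M N') place"
  interpret C: sigma_finite_measure "count_space (UNIV :: bool set)"
    by (rule sigma_finite_measure_count_space_finite) simp
  interpret MC: pair_sigma_finite M "count_space (UNIV :: bool set)" ..
  interpret R: pair_sigma_finite M "M \<Otimes>\<^sub>M count_space (UNIV :: bool set)" ..
  interpret R: sigma_finite_measure R unfolding R_def by unfold_locales
  show ?thesis
  proof (intro exI[of _ \<pi>'] conjI ballI)
    fix f :: "_ \<Rightarrow> ennreal" assume f [measurable]: "f \<in> borel_measurable (N' \<Otimes>\<^sub>M N')"
    have "(\<integral>\<^sup>+z. f z \<partial>\<pi>') = (\<integral>\<^sup>+y. dens y * f (place y) \<partial>(\<pi> \<Otimes>\<^sub>M R))"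
      unfolding \<pi>'_def by (simp add: nn_integral_distr nn_integral_density)
    also have "\<dots> = (\<integral>\<^sup>+z. \<integral>\<^sup>+r. dens (z, r) * f (place (z, r)) \<partial>R \<partial>\<pi>)"
      by (subst R.nn_integral_fst[symmetric]) auto
    also have "\<dots> = (\<integral>\<^sup>+z. maximal_coupling M (\<rho> (fst z)) (\<lambda>(u, v). f (T (fst z, u), T (snd z, v))) \<partial>\<pi>)"
    proof (rule nn_integral_cong)
      fix z assume z: "z \<in> space \<pi>"
      define k where "k r = dens (z, r) * f (place (z, r))" for r
      have "k \<in> borel_measurable R"
        unfolding k_def by (rule measurable_Pair2[OF _ z]) measurable
      then have [measurable]: "k \<in> borel_measurable (M \<Otimes>\<^sub>M (M \<Otimes>\<^sub>M count_space UNIV))"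
        unfolding R_def .
      have "(\<integral>\<^sup>+r. k r \<partial>R) = (\<integral>\<^sup>+u. \<integral>\<^sup>+s. k (u, s) \<partial>(M \<Otimes>\<^sub>M count_space UNIV) \<partial>M)"
        unfolding R_def by (rule MC.nn_integral_fst[symmetric]) measurable
      also have "\<dots> = (\<integral>\<^sup>+u. \<integral>\<^sup>+v. \<integral>\<^sup>+b. k (u, v, b) \<partial>count_space UNIV \<partial>M \<partial>M)"
        by (intro nn_integral_cong C.nn_integral_fst[symmetric]) measurable
      also have "\<dots> = (\<integral>\<^sup>+u. \<integral>\<^sup>+v. k (u, v, False) + k (u, v, True) \<partial>M \<partial>M)"
        by (simp add: nn_integral_count_space_finite UNIV_bool)
      also have "\<dots> = (\<integral>\<^sup>+u. (\<integral>\<^sup>+v. k (u, v, False) \<partial>M) + (\<integral>\<^sup>+v. k (u, v, True) \<partial>M) \<partial>M)"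
        by (intro nn_integral_cong nn_integral_add) measurable
      also have "\<dots> = (\<integral>\<^sup>+u. \<integral>\<^sup>+v. k (u, v, False) \<partial>M \<partial>M) + (\<integral>\<^sup>+u. \<integral>\<^sup>+v. k (u, v, True) \<partial>M \<partial>M)"
        by (intro nn_integral_add) measurable
      also have "(\<integral>\<^sup>+u. \<integral>\<^sup>+v. k (u, v, False) \<partial>M \<partial>M)
          = (\<integral>\<^sup>+u. ennreal (min (\<rho> (fst z) u) 1) * f (T (fst z, u), T (snd z, u)) \<partial>M)"
        by (simp add: k_def dens_def place_def emeasure_space_1)
      finally show "(\<integral>\<^sup>+r. dens (z, r) * f (place (z, r)) \<partial>R) =
          maximal_coupling M (\<rho> (fst z)) (\<lambda>(u, v). f (T (fst z, u), T (snd z, v)))"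
        unfolding k_def[symmetric]
        by (simp add: maximal_coupling_def k_def dens_def place_def m_def)
    qed
    finally show "(\<integral>\<^sup>+z. f z \<partial>\<pi>') = \<dots>" .
  qed (simp add: \<pi>'_def)
qed

text \<open>The chain rule rests on \<open>ent_fun (h r) = h * ent_fun r + ent_fun h + (r - 1) * h * ln h\<close>, where
  the last term integrates to zero; its sign decides on which side it can be kept nonnegative.\<close>

lemma entropy_chain_rule:
  assumes [measurable]: "\<rho> \<in> borel_measurable M" and nn: "\<And>u. 0 \<le> \<rho> u"
    and one: "(\<integral>\<^sup>+u. ennreal (\<rho> u) \<partial>M) = 1" and h: "0 \<le> h"
  shows "ennreal h * (\<integral>\<^sup>+u. ennreal (ent_fun (\<rho> u)) \<partial>M) + ennreal (ent_fun h)
    = (\<integral>\<^sup>+u. ennreal (ent_fun (h * \<rho> u)) \<partial>M)"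
proof (cases "h = 0")
  case True
  \<comment> \<open>Both sides equal \<open>ent_fun 0 = 1\<close>: the entropy of
    \<open>\<rho>\<close>, even if infinite, is multiplied by 0.\<close>
  then show ?thesis by (simp add: ent_fun_def emeasure_space_1)
next
  case False
  with h have h0: "h > 0" by simp
  define c where "c = h * ln h"
  have id: "ent_fun (h * r) + c = h * ent_fun r + ent_fun h + r * c" if "r \<ge> 0" for r
    using that h0 by (cases "r = 0") (auto simp: ent_fun_def c_def ln_mult algebra_simps)
  have I: "(\<integral>\<^sup>+u. ennreal h * ennreal (ent_fun (\<rho> u)) + ennreal (ent_fun h) + ennreal (\<rho> u) * ennreal a \<partial>M)
    = ennreal h * (\<integral>\<^sup>+u. ennreal (ent_fun (\<rho> u)) \<partial>M) + ennreal (ent_fun h) + ennreal a" for a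
    by (simp add: nn_integral_add nn_integral_cmult nn_integral_multc one emeasure_space_1)
  have J: "(\<integral>\<^sup>+u. ennreal (ent_fun (h * \<rho> u)) + ennreal a \<partial>M)
    = (\<integral>\<^sup>+u. ennreal (ent_fun (h * \<rho> u)) \<partial>M) + ennreal a" for a
    by (simp add: nn_integral_add emeasure_space_1)
  note pos = ent_fun_nonneg[OF nn] ent_fun_nonneg[OF h] ent_fun_nonneg[OF mult_nonneg_nonneg[OF h nn]] h nn
  show ?thesis
  proof (cases "c \<ge> 0")
    case True
    have "(\<integral>\<^sup>+u. ennreal h * ennreal (ent_fun (\<rho> u)) + ennreal (ent_fun h) + ennreal (\<rho> u) * ennreal c \<partial>M)
      = (\<integral>\<^sup>+u. ennreal (ent_fun (h * \<rho> u)) + ennreal c \<partial>M)"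
      using pos True id[OF nn]
      by (intro nn_integral_cong) (simp add: ennreal_mult[symmetric] ennreal_plus[symmetric] del: ennreal_plus)
    then show ?thesis unfolding I J by (rule ennreal_cancel_right)
  next
    case False
    define d where "d = - c"
    have d: "d \<ge> 0" "0 \<le> \<rho> u * d" for u using False nn[of u] by (auto simp: d_def mult_nonneg_nonpos)
    have id': "ent_fun (h * \<rho> u) + \<rho> u * d = h * ent_fun (\<rho> u) + ent_fun h + d" for u
      using id[OF nn[of u]] by (simp add: d_def)
    have "ennreal h * ennreal (ent_fun (\<rho> u)) + ennreal (ent_fun h) + ennreal d
        = ennreal (ent_fun (h * \<rho> u)) + ennreal (\<rho> u) * ennreal d" for u
      using pos d id'[of u]
      by (simp add: ennreal_mult[symmetric] ennreal_plus[symmetric] del: ennreal_plus)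
    then have "(\<integral>\<^sup>+u. ennreal h * ennreal (ent_fun (\<rho> u)) + ennreal (ent_fun h) + ennreal d \<partial>M)
      = (\<integral>\<^sup>+u. ennreal (ent_fun (h * \<rho> u)) + ennreal (\<rho> u) * ennreal d \<partial>M)"
      by simp
    then have "(ennreal h * (\<integral>\<^sup>+u. ennreal (ent_fun (\<rho> u)) \<partial>M) + ennreal (ent_fun h)) + ennreal d
      = (\<integral>\<^sup>+u. ennreal (ent_fun (h * \<rho> u)) \<partial>M) + ennreal d"
      by (simp add: nn_integral_add nn_integral_cmult nn_integral_multc one emeasure_space_1)
    then show ?thesis by (rule ennreal_cancel_right)
  qed
qed

end

section \<open>Coupling the noise\<close>

abbreviation noise :: "'g measure \<Rightarrow> nat \<Rightarrow> (nat \<Rightarrow> 'g) measure" where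
  "noise \<gamma> n \<equiv> \<Pi>\<^sub>M i\<in>{Suc 0..n}. \<gamma>"

text \<open>The canonical realisation: the sample point is the noise sequence itself.\<close>

abbreviation state :: "('a \<Rightarrow> 'g \<Rightarrow> 'a) \<Rightarrow> nat \<Rightarrow> 'a \<Rightarrow> (nat \<Rightarrow> 'g) \<Rightarrow> 'a" where
  "state F \<equiv> rds F (\<lambda>k w. w k)"

lemma state_cong: "(\<And>k. 1 \<le> k \<Longrightarrow> k \<le> n \<Longrightarrow> v k = w k) \<Longrightarrow> state F n x v = state F n x w"
  by (induction n) auto

text \<open>Causality: noise number \<open>Suc n\<close> leaves the states up to time
  \<open>n\<close> unchanged.\<close>

lemma state_upd: "m \<le> n \<Longrightarrow> state F m x (w(Suc n := u)) = state F m x w"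
  by (rule state_cong) auto

lemma measurable_state:
  fixes F :: "'a::topological_space \<Rightarrow> 'g \<Rightarrow> 'a"
  assumes [measurable]: "(\<lambda>(x, w). F x w) \<in> borel \<Otimes>\<^sub>M \<gamma> \<rightarrow>\<^sub>M borel"
  shows "m \<le> n \<Longrightarrow> state F m x \<in> noise \<gamma> n \<rightarrow>\<^sub>M borel"
proof (induction m)
  case 0
  have "state F 0 x = (\<lambda>_. x)" by (simp add: fun_eq_iff)
  then show ?case by simp
next
  case (Suc m)
  then have state: "state F m x \<in> noise \<gamma> n \<rightarrow>\<^sub>M borel" and "Suc m \<in> {Suc 0..n}" by auto
  from this(2) have noise: "(\<lambda>w. w (Suc m)) \<in> noise \<gamma> n \<rightarrow>\<^sub>M \<gamma>"
    by (rule measurable_component_singleton)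
  have "(\<lambda>w. F (state F m x w) (w (Suc m))) \<in> noise \<gamma> n \<rightarrow>\<^sub>M borel"
    using measurable_compose[OF measurable_Pair[OF state noise] assms] by simp
  then show ?case by (simp cong: measurable_cong)
qed

section \<open>Integration over the noise one coordinate at a time\<close>

context prob_space
begin

lemma prob_space_noise: "prob_space (noise M n)"
  by (intro prob_space_PiM prob_space_axioms)

lemma nn_integral_noise_Suc:
  assumes "f \<in> borel_measurable (noise M (Suc n))"
  shows "(\<integral>\<^sup>+w. f w \<partial>noise M (Suc n)) = (\<integral>\<^sup>+w. \<integral>\<^sup>+u. f (w(Suc n := u)) \<partial>M \<partial>noise M n)"
proof -
  interpret P: product_sigma_finite "\<lambda>_::nat. M" by unfold_locales
  show ?thesis
    using assms P.product_nn_integral_insert[of "{Suc 0..n}" "Suc n" f]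
    by (simp add: atLeastAtMostSuc_conv)
qed

lemma measurable_noise_upd [measurable]:
  "(\<lambda>(w, u). w(Suc n := u)) \<in> noise M n \<Otimes>\<^sub>M M \<rightarrow>\<^sub>M noise M (Suc n)"
  using measurable_add_dim[of "Suc n" "{Suc 0..n}" "\<lambda>_. M"] by (simp add: atLeastAtMostSuc_conv)

end

text \<open>\<open>V\<close> is the Lyapunov function that charges a displacement with all the distances it causes later.\<close>

locale dissipative_rds = prob_space \<gamma> for \<gamma> :: "'g measure" +
  fixes F :: "'a::{metric_space, second_countable_topology} \<Rightarrow> 'g \<Rightarrow> 'a"
    and V :: "'a \<Rightarrow> 'a \<Rightarrow> ennreal" and L del K :: real
  assumes F_meas [measurable]: "(\<lambda>(x, w). F x w) \<in> borel \<Otimes>\<^sub>M \<gamma> \<rightarrow>\<^sub>M borel"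
    and V_meas [measurable]: "(\<lambda>(x, y). V x y) \<in> borel_measurable (borel \<Otimes>\<^sub>M borel)"
    and V_tri: "\<And>x y z. V x z \<le> V x y + V y z"
    and V_ge: "\<And>x y. ennreal (dist x y) \<le> V x y"
    and V_le: "\<And>x y. V x y \<le> ennreal (L * dist x y)"
    and V_decr: "\<And>x y. (\<integral>\<^sup>+w. V (F x w) (F y w) \<partial>\<gamma>) + ennreal (dist x y) \<le> V x y"
    and L_pos: "0 < L" and del_pos: "0 < del" and K_nn: "0 \<le> K"
    and exp_le: "\<And>x. (\<integral>\<^sup>+u. \<integral>\<^sup>+v. ennreal (exp (del * (dist (F x u) (F x v))\<^sup>2)) \<partial>\<gamma> \<partial>\<gamma>) \<le> ennreal K"
begin

text \<open>The sum is the cost already incurred; \<open>V\<close> stands for the present distance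
  together with all that synchronous noise would still add.\<close>

definition potential :: "nat \<Rightarrow> 'a \<Rightarrow> (nat \<Rightarrow> 'g) \<Rightarrow> (nat \<Rightarrow> 'g) \<Rightarrow> ennreal" where
  "potential n x w w' =
     (\<Sum>j<n. ennreal (dist (state F j x w) (state F j x w'))) + V (state F n x w) (state F n x w')"

section \<open>Growth of the potential in one step\<close>

lemma V_refl: "V x x = 0"
  using V_le[of x x] by simp

lemma measurable_potential [measurable]:
  "(\<lambda>(w, w'). potential n x w w') \<in> borel_measurable (noise \<gamma> n \<Otimes>\<^sub>M noise \<gamma> n)"
proof -
  have [measurable]: "state F j x \<in> noise \<gamma> n \<rightarrow>\<^sub>M borel" if "j \<le> n" for j
    by (rule measurable_state[OF F_meas that])
  show ?thesis unfolding potential_def by measurable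
qed

text \<open>The path cost runs over times 1 to \<open>n\<close>, the sum in the potential over 0 to
  \<open>n - 1\<close>; the missing last distance is at most \<open>V\<close>.\<close>

lemma dist_l1_le_potential:
  "ennreal (dist_l1 n (\<lambda>k\<in>{1..n}. state F k x w) (\<lambda>k\<in>{1..n}. state F k x w')) \<le> potential n x w w'"
proof (cases n)
  case (Suc m)
  let ?d = "\<lambda>j. ennreal (dist (state F j x w) (state F j x w'))"
  have "ennreal (dist_l1 n (\<lambda>k\<in>{1..n}. state F k x w) (\<lambda>k\<in>{1..n}. state F k x w')) = (\<Sum>j=1..n. ?d j)"
    by (simp add: dist_l1_def flip: sum_ennreal)
  also have "\<dots> \<le> (\<Sum>j\<in>insert n {..<n}. ?d j)"
    by (intro sum_mono2) auto
  also have "\<dots> \<le> potential n x w w'"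
    unfolding potential_def using V_ge by (simp add: add.commute add_left_mono del: sum_ennreal)
  finally show ?thesis .
qed (simp add: dist_l1_def)

text \<open>The intermediate point \<open>F (state F n x w) v\<close> starts from the first state
  but uses the second noise. Passing through it splits the step into a change of noise at a fixed
  state, which costs at most \<open>L\<close> times the distance, and a synchronous step, which
  \<open>V_decr\<close> controls.\<close>

lemma potential_Suc_le:
  "potential (Suc n) x (w(Suc n := u)) (w'(Suc n := v)) \<le>
     (\<Sum>j<n. ennreal (dist (state F j x w) (state F j x w')))
     + ennreal (dist (state F n x w) (state F n x w'))
     + V (F (state F n x w) v) (F (state F n x w') v)
     + ennreal L * ennreal (dist (F (state F n x w) u) (F (state F n x w) v))"
proof -
  have "V (F (state F n x w) u) (F (state F n x w') v) \<le>
    V (F (state F n x w) u) (F (state F n x w) v) + V (F (state F n x w) v) (F (state F n x w') v)"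
    by (rule V_tri)
  also have "\<dots> \<le> V (F (state F n x w) v) (F (state F n x w') v)
     + ennreal L * ennreal (dist (F (state F n x w) u) (F (state F n x w) v))"
    using V_le L_pos by (subst add.commute) (auto intro!: add_left_mono simp: ennreal_mult[symmetric])
  finally show ?thesis
    by (simp add: potential_def state_upd add_ac add_left_mono del: sum_ennreal cong: sum.cong_simp)
qed

text \<open>The synchronous part depends on \<open>v\<close> alone, whose law is the reference law,
  so \<open>V_decr\<close> applies and pays for the newly counted distance. The rest is the maximal
  coupling cost for noise acting at one fixed state.\<close>

lemma step_cost_le:
  assumes [measurable]: "\<rho> \<in> borel_measurable \<gamma>" and nn: "\<And>u. 0 \<le> \<rho> u"
    and one: "(\<integral>\<^sup>+u. ennreal (\<rho> u) \<partial>\<gamma>) = 1" and lam: "lam > 0"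
  shows "maximal_coupling \<gamma> \<rho> (\<lambda>(u, v). potential (Suc n) x (w(Suc n := u)) (w'(Suc n := v))) \<le>
    potential n x w w' + ennreal L * (ennreal (1 / lam) * (\<integral>\<^sup>+u. ennreal (ent_fun (\<rho> u)) \<partial>\<gamma>) +
      ennreal (lam * (1 + 4 * K) / del))"
proof -
  define y where "y = state F n x w"
  define y' where "y' = state F n x w'"
  define s where "s = (\<Sum>j<n. ennreal (dist (state F j x w) (state F j x w')))"
  define f where "f v = s + ennreal (dist y y') + V (F y v) (F y' v)" for v
  define D where "D u v = dist (F y u) (F y v)" for u v
  have [measurable]: "f \<in> borel_measurable \<gamma>" unfolding f_def by measurable
  have D_meas [measurable]: "(\<lambda>(u, v). D u v) \<in> borel_measurable (\<gamma> \<Otimes>\<^sub>M \<gamma>)" unfolding D_def by measurable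
  have "maximal_coupling \<gamma> \<rho> (\<lambda>(u, v). potential (Suc n) x (w(Suc n := u)) (w'(Suc n := v)))
    \<le> maximal_coupling \<gamma> \<rho> (\<lambda>z. (case z of (u, v) \<Rightarrow> f v) + ennreal L * (case z of (u, v) \<Rightarrow> ennreal (D u v)))"
    by (rule maximal_coupling_mono) (use potential_Suc_le[of n x w _ w'] in \<open>simp add: f_def D_def s_def y_def y'_def del: sum_ennreal\<close>)
  also have "\<dots> = maximal_coupling \<gamma> \<rho> (\<lambda>(u, v). f v) + ennreal L * maximal_coupling \<gamma> \<rho> (\<lambda>(u, v). ennreal (D u v))"
    by (subst maximal_coupling_add, measurable, subst maximal_coupling_cmult) measurable
  also have "\<dots> \<le> potential n x w w' + ennreal L * (ennreal (1 / lam) * (\<integral>\<^sup>+u. ennreal (ent_fun (\<rho> u)) \<partial>\<gamma>) +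
      ennreal (lam * (1 + 4 * K) / del))"
  proof (intro add_mono mult_left_mono)
    have "maximal_coupling \<gamma> \<rho> (\<lambda>(u, v). f v) = (\<integral>\<^sup>+v. f v \<partial>\<gamma>)"
      by (rule maximal_coupling_snd) (use nn one in auto)
    also have "\<dots> = s + ennreal (dist y y') + (\<integral>\<^sup>+v. V (F y v) (F y' v) \<partial>\<gamma>)"
      unfolding f_def by (subst nn_integral_add) (auto simp: emeasure_space_1)
    also have "\<dots> \<le> potential n x w w'"
      using V_decr[of y y'] by (simp add: potential_def s_def y_def y'_def add_ac add_left_mono del: sum_ennreal)
    finally show "maximal_coupling \<gamma> \<rho> (\<lambda>(u, v). f v) \<le> potential n x w w'" .
    show "maximal_coupling \<gamma> \<rho> (\<lambda>(u, v). ennreal (D u v)) \<le> ennreal (1 / lam) * (\<integral>\<^sup>+u. ennreal (ent_fun (\<rho> u)) \<partial>\<gamma>) +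
      ennreal (lam * (1 + 4 * K) / del)"
      by (rule maximal_coupling_cost)
         (use nn one lam del_pos K_nn exp_le in \<open>auto simp: D_def dist_commute intro: dist_triangle\<close>)
  qed simp
  finally show ?thesis .
qed

text \<open>Off the null set of prefixes with infinite marginal density the second factor is the
  conditional density; the totalised version integrates to 1 everywhere.\<close>

lemma disintegrate_density:
  assumes h_meas [measurable]: "h \<in> borel_measurable (noise \<gamma> (Suc n))" and nn: "\<And>w. 0 \<le> h w"
    and one: "(\<integral>\<^sup>+w. ennreal (h w) \<partial>noise \<gamma> (Suc n)) = 1"
  obtains h' :: "(nat \<Rightarrow> 'g) \<Rightarrow> real" and \<rho> :: "(nat \<Rightarrow> 'g) \<Rightarrow> 'g \<Rightarrow> real"
  where "h' \<in> borel_measurable (noise \<gamma> n)" "\<And>w. 0 \<le> h' w" "(\<integral>\<^sup>+w. ennreal (h' w) \<partial>noise \<gamma> n) = 1"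
    and "(\<lambda>(w, u). \<rho> w u) \<in> borel_measurable (noise \<gamma> n \<Otimes>\<^sub>M \<gamma>)" "\<And>w u. 0 \<le> \<rho> w u"
    and "\<And>w. w \<in> space (noise \<gamma> n) \<Longrightarrow> (\<integral>\<^sup>+u. ennreal (\<rho> w u) \<partial>\<gamma>) = 1"
    and "AE w in noise \<gamma> n. AE u in \<gamma>. h (w(Suc n := u)) = h' w * \<rho> w u"
proof -
  define I where "I w = (\<integral>\<^sup>+u. ennreal (h (w(Suc n := u))) \<partial>\<gamma>)" for w
  have slice [measurable]: "(\<lambda>(w, u). h (w(Suc n := u))) \<in> borel_measurable (noise \<gamma> n \<Otimes>\<^sub>M \<gamma>)"
    using measurable_compose[OF measurable_noise_upd h_meas] by (simp add: split_beta')
  have [measurable]: "I \<in> borel_measurable (noise \<gamma> n)" unfolding I_def by measurable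
  have I_one: "(\<integral>\<^sup>+w. I w \<partial>noise \<gamma> n) = 1"
    unfolding I_def one[symmetric] by (rule nn_integral_noise_Suc[symmetric]) measurable
  have I_fin: "AE w in noise \<gamma> n. I w \<noteq> \<infinity>"
  proof (rule nn_integral_PInf_AE)
    show "I \<in> borel_measurable (noise \<gamma> n)" by measurable
    show "(\<integral>\<^sup>+w. I w \<partial>noise \<gamma> n) \<noteq> \<infinity>" unfolding I_one by simp
  qed
  define h' where "h' w = enn2real (I w)" for w
  \<comment> \<open>As \<open>enn2real\<close> sends infinity to 0, the default 1 is also taken at
    prefixes with infinite marginal density.\<close>
  define \<rho> where "\<rho> w u = (if h' w = 0 then 1 else h (w(Suc n := u)) / h' w)" for w u
  have [measurable]: "h' \<in> borel_measurable (noise \<gamma> n)" unfolding h'_def by measurable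
  have [measurable]: "(\<lambda>(w, u). \<rho> w u) \<in> borel_measurable (noise \<gamma> n \<Otimes>\<^sub>M \<gamma>)" unfolding \<rho>_def by measurable
  have h'_nn: "0 \<le> h' w" for w by (simp add: h'_def)
  show thesis
  proof (rule that[of h' \<rho>])
    show "h' \<in> borel_measurable (noise \<gamma> n)" "(\<lambda>(w, u). \<rho> w u) \<in> borel_measurable (noise \<gamma> n \<Otimes>\<^sub>M \<gamma>)"
      by measurable
    show "0 \<le> h' w" for w by fact
    show "0 \<le> \<rho> w u" for w u using nn h'_nn by (simp add: \<rho>_def)
    have "AE w in noise \<gamma> n. ennreal (h' w) = I w"
      using I_fin by eventually_elim (simp add: h'_def top.not_eq_extremum)
    then show "(\<integral>\<^sup>+w. ennreal (h' w) \<partial>noise \<gamma> n) = 1"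
      using I_one by (simp cong: nn_integral_cong_AE)
    show "(\<integral>\<^sup>+u. ennreal (\<rho> w u) \<partial>\<gamma>) = 1" if w: "w \<in> space (noise \<gamma> n)" for w
    proof (cases "h' w = 0")
      case True
      then show ?thesis by (simp add: \<rho>_def emeasure_space_1)
    next
      case False
      then have pos: "h' w > 0" using h'_nn[of w] by simp
      then have Iw: "I w = ennreal (h' w)" by (cases "I w") (auto simp: h'_def)
      have [measurable]: "(\<lambda>u. h (w(Suc n := u))) \<in> borel_measurable \<gamma>"
        using measurable_Pair2[OF slice w] by simp
      have "(\<integral>\<^sup>+u. ennreal (\<rho> w u) \<partial>\<gamma>) = (\<integral>\<^sup>+u. ennreal (h (w(Suc n := u))) / ennreal (h' w) \<partial>\<gamma>)"
        using pos nn False by (intro nn_integral_cong) (simp add: \<rho>_def divide_ennreal)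
      also have "\<dots> = I w / ennreal (h' w)"
        unfolding I_def by (rule nn_integral_divide) measurable
      also have "\<dots> = 1" unfolding Iw using pos by (simp add: divide_ennreal)
      finally show ?thesis .
    qed
    show "AE w in noise \<gamma> n. AE u in \<gamma>. h (w(Suc n := u)) = h' w * \<rho> w u"
      using I_fin AE_space
    proof eventually_elim
      fix w assume fin: "I w \<noteq> \<infinity>" and w: "w \<in> space (noise \<gamma> n)"
      have [measurable]: "(\<lambda>u. h (w(Suc n := u))) \<in> borel_measurable \<gamma>"
        using measurable_Pair2[OF slice w] by simp
      show "AE u in \<gamma>. h (w(Suc n := u)) = h' w * \<rho> w u"
      proof (cases "h' w = 0")
        case True
        \<comment> \<open>A zero marginal density forces \<open>h\<close> to vanish almost
          everywhere on the fibre, in agreement with \<open>h' w * 1 = 0\<close>.\<close>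
        then have "I w = 0" using fin by (cases "I w") (auto simp: h'_def)
        then have "AE u in \<gamma>. ennreal (h (w(Suc n := u))) = 0"
          unfolding I_def by (subst (asm) nn_integral_0_iff_AE) auto
        then show ?thesis
          by eventually_elim (use nn True in \<open>auto simp: ennreal_eq_0_iff intro: antisym\<close>)
      qed (simp add: \<rho>_def)
    qed
  qed
qed

text \<open>The marginals, the noise law with density \<open>h\<close> and the noise law itself, are
  expressed through nonnegative test functions, the form in which kernels are integrated. The cost
  bound has a fixed \<open>lam\<close>, so that it adds up over the steps.\<close>

definition entropic_coupling ::
  "nat \<Rightarrow> 'a \<Rightarrow> real \<Rightarrow> ((nat \<Rightarrow> 'g) \<Rightarrow> real) \<Rightarrow> ((nat \<Rightarrow> 'g) \<times> (nat \<Rightarrow> 'g)) measure \<Rightarrow> bool" where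
  "entropic_coupling n x lam h \<pi> \<longleftrightarrow>
    sets \<pi> = sets (noise \<gamma> n \<Otimes>\<^sub>M noise \<gamma> n) \<and>
    (\<forall>f\<in>borel_measurable (noise \<gamma> n). (\<integral>\<^sup>+z. f (fst z) \<partial>\<pi>) = (\<integral>\<^sup>+w. ennreal (h w) * f w \<partial>noise \<gamma> n)) \<and>
    (\<forall>f\<in>borel_measurable (noise \<gamma> n). (\<integral>\<^sup>+z. f (snd z) \<partial>\<pi>) = (\<integral>\<^sup>+w. f w \<partial>noise \<gamma> n)) \<and>
    (\<integral>\<^sup>+z. potential n x (fst z) (snd z) \<partial>\<pi>) \<le> ennreal L * (ennreal (1 / lam) *
      (\<integral>\<^sup>+w. ennreal (ent_fun (h w)) \<partial>noise \<gamma> n) + of_nat n * ennreal (lam * (1 + 4 * K) / del))"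

text \<open>Induction over the number of coordinates with \<open>h\<close> varying, because the
  hypothesis is applied to the marginal density \<open>h'\<close> of the prefix. The new pair of
  coordinates is then drawn from the maximal coupling for the conditional density given the tilted
  prefix.\<close>

lemma exists_entropic_coupling:
  assumes "h \<in> borel_measurable (noise \<gamma> n)" and "\<And>w. 0 \<le> h w"
    and "(\<integral>\<^sup>+w. ennreal (h w) \<partial>noise \<gamma> n) = 1" and lam: "lam > 0"
  shows "\<exists>\<pi>. entropic_coupling n x lam h \<pi>"
  using assms(1-3)
proof (induction n arbitrary: h)
  case 0
  \<comment> \<open>Without coordinates the noise space is a single point, so \<open>h\<close> is 1
    there and the diagonal is the coupling; both trajectories are still at \<open>x\<close>, so the
    potential is 0.\<close>
  let ?\<pi> = "distr (noise \<gamma> 0) (noise \<gamma> 0 \<Otimes>\<^sub>M noise \<gamma> 0) (\<lambda>w. (w, w))"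
  have eval: "(\<integral>\<^sup>+w. f w \<partial>noise \<gamma> 0) = f (\<lambda>k. undefined)" for f
    by (simp add: PiM_empty nn_integral_count_space_finite)
  have one: "ennreal (h (\<lambda>k. undefined)) = 1" using "0.prems"(3) unfolding eval .
  have pot: "potential 0 x w w' = 0" for w w' by (simp add: potential_def V_refl)
  have marginals: "(\<integral>\<^sup>+z. f (fst z) \<partial>?\<pi>) = (\<integral>\<^sup>+w. f w \<partial>noise \<gamma> 0)"
    "(\<integral>\<^sup>+z. f (snd z) \<partial>?\<pi>) = (\<integral>\<^sup>+w. f w \<partial>noise \<gamma> 0)"
    if [measurable]: "f \<in> borel_measurable (noise \<gamma> 0)" for f :: "_ \<Rightarrow> ennreal"
    by (subst nn_integral_distr; measurable; simp only: fst_conv snd_conv)+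
  show ?case
    unfolding entropic_coupling_def
  proof (intro exI[of _ ?\<pi>] conjI ballI)
    fix f :: "_ \<Rightarrow> ennreal" assume f: "f \<in> borel_measurable (noise \<gamma> 0)"
    show "(\<integral>\<^sup>+z. f (fst z) \<partial>?\<pi>) = (\<integral>\<^sup>+w. ennreal (h w) * f w \<partial>noise \<gamma> 0)"
      unfolding marginals(1)[OF f] eval one by simp
    show "(\<integral>\<^sup>+z. f (snd z) \<partial>?\<pi>) = (\<integral>\<^sup>+w. f w \<partial>noise \<gamma> 0)"
      by (rule marginals(2)[OF f])
  qed (simp_all only: pot sets_distr nn_integral_const mult_zero_left zero_le)
next
  case (Suc n)
  note [measurable] = Suc.prems(1)
  obtain h' \<rho> where h'_meas [measurable]: "h' \<in> borel_measurable (noise \<gamma> n)" and h'_nn: "\<And>w. 0 \<le> h' w"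
    and h'_one: "(\<integral>\<^sup>+w. ennreal (h' w) \<partial>noise \<gamma> n) = 1"
    and \<rho>_meas [measurable]: "(\<lambda>(w, u). \<rho> w u) \<in> borel_measurable (noise \<gamma> n \<Otimes>\<^sub>M \<gamma>)" and \<rho>_nn: "\<And>w u. 0 \<le> \<rho> w u"
    and \<rho>_one: "\<And>w. w \<in> space (noise \<gamma> n) \<Longrightarrow> (\<integral>\<^sup>+u. ennreal (\<rho> w u) \<partial>\<gamma>) = 1"
    and h_eq: "AE w in noise \<gamma> n. AE u in \<gamma>. h (w(Suc n := u)) = h' w * \<rho> w u"
    by (rule disintegrate_density[OF Suc.prems]) (rule that; (assumption | simp))
  obtain \<pi> where \<pi>: "entropic_coupling n x lam h' \<pi>"
    using Suc.IH[OF h'_meas h'_nn h'_one] by (rule exE)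
  have sets_\<pi>: "sets \<pi> = sets (noise \<gamma> n \<Otimes>\<^sub>M noise \<gamma> n)"
    and \<pi>_fst: "\<And>f. f \<in> borel_measurable (noise \<gamma> n) \<Longrightarrow> (\<integral>\<^sup>+z. f (fst z) \<partial>\<pi>) = (\<integral>\<^sup>+w. ennreal (h' w) * f w \<partial>noise \<gamma> n)"
    and \<pi>_snd: "\<And>f. f \<in> borel_measurable (noise \<gamma> n) \<Longrightarrow> (\<integral>\<^sup>+z. f (snd z) \<partial>\<pi>) = (\<integral>\<^sup>+w. f w \<partial>noise \<gamma> n)"
    and \<pi>_cost: "(\<integral>\<^sup>+z. potential n x (fst z) (snd z) \<partial>\<pi>) \<le> ennreal L * (ennreal (1 / lam) *
      (\<integral>\<^sup>+w. ennreal (ent_fun (h' w)) \<partial>noise \<gamma> n) + of_nat n * ennreal (lam * (1 + 4 * K) / del))"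
    using \<pi> unfolding entropic_coupling_def by blast+
  note [measurable_cong] = sets_\<pi>
  interpret noise: prob_space "noise \<gamma> n" by (rule prob_space_noise)
  have \<pi>_space: "fst z \<in> space (noise \<gamma> n)" "snd z \<in> space (noise \<gamma> n)" if "z \<in> space \<pi>" for z
    using that unfolding sets_eq_imp_space_eq[OF sets_\<pi>] space_pair_measure mem_Times_iff by blast+
  have \<pi>_mass: "emeasure \<pi> (space \<pi>) = 1"
    using \<pi>_snd[of "\<lambda>_. 1"] by (simp add: noise.emeasure_space_1)
  have \<rho>_meas' [measurable]: "\<rho> w \<in> borel_measurable \<gamma>" if "w \<in> space (noise \<gamma> n)" for w
    using measurable_Pair2[OF \<rho>_meas that] by simp
  \<comment> \<open>The kernel depends only on the tilted prefix \<open>fst z\<close>; the reference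
    prefix \<open>snd z\<close> is merely extended.\<close>
  obtain \<pi>' where sets_\<pi>': "sets \<pi>' = sets (noise \<gamma> (Suc n) \<Otimes>\<^sub>M noise \<gamma> (Suc n))"
    and \<pi>': "\<And>f. f \<in> borel_measurable (noise \<gamma> (Suc n) \<Otimes>\<^sub>M noise \<gamma> (Suc n)) \<Longrightarrow> (\<integral>\<^sup>+z. f z \<partial>\<pi>') =
      (\<integral>\<^sup>+z. maximal_coupling \<gamma> (\<rho> (fst z)) (\<lambda>(u, v). f ((fst z)(Suc n := u), (snd z)(Suc n := v))) \<partial>\<pi>)"
    using coupling_extension[OF sets_\<pi> \<rho>_meas measurable_noise_upd] by auto
  have slice: "(\<lambda>u. f (w(Suc n := u))) \<in> borel_measurable \<gamma>"
    if "f \<in> borel_measurable (noise \<gamma> (Suc n))" "w \<in> space (noise \<gamma> n)" for w and f :: "_ \<Rightarrow> ennreal"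
    using measurable_Pair2[OF measurable_compose[OF measurable_noise_upd that(1)] that(2)] by simp
  show ?case
    unfolding entropic_coupling_def
  proof (intro exI[of _ \<pi>'] conjI ballI)
    fix f :: "_ \<Rightarrow> ennreal" assume f [measurable]: "f \<in> borel_measurable (noise \<gamma> (Suc n))"
    have [measurable]: "(\<lambda>(w, u). f (w(Suc n := u))) \<in> borel_measurable (noise \<gamma> n \<Otimes>\<^sub>M \<gamma>)"
      using measurable_compose[OF measurable_noise_upd f] by (simp add: split_beta')
    have "(\<integral>\<^sup>+z. f (fst z) \<partial>\<pi>') =
      (\<integral>\<^sup>+z. maximal_coupling \<gamma> (\<rho> (fst z)) (\<lambda>(u, v). f ((fst z)(Suc n := u))) \<partial>\<pi>)"
      by (subst \<pi>') auto
    also have "\<dots> = (\<integral>\<^sup>+z. \<integral>\<^sup>+u. ennreal (\<rho> (fst z) u) * f ((fst z)(Suc n := u)) \<partial>\<gamma> \<partial>\<pi>)"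
      by (intro nn_integral_cong maximal_coupling_fst \<rho>_meas' \<rho>_nn \<rho>_one slice f \<pi>_space)
    \<comment> \<open>The inner integral is now a function of the tilted prefix, so the first
      marginal of \<open>\<pi>\<close> applies, and \<open>h'\<close> times \<open>\<rho>\<close>
      restores \<open>h\<close>.\<close>
    also have "\<dots> = (\<integral>\<^sup>+w. ennreal (h' w) * (\<integral>\<^sup>+u. ennreal (\<rho> w u) * f (w(Suc n := u)) \<partial>\<gamma>) \<partial>noise \<gamma> n)"
      by (rule \<pi>_fst[of "\<lambda>w. \<integral>\<^sup>+u. ennreal (\<rho> w u) * f (w(Suc n := u)) \<partial>\<gamma>"]) measurable
    also have "\<dots> = (\<integral>\<^sup>+w. \<integral>\<^sup>+u. ennreal (h (w(Suc n := u))) * f (w(Suc n := u)) \<partial>\<gamma> \<partial>noise \<gamma> n)"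
    proof (rule nn_integral_cong_AE)
      show "AE w in noise \<gamma> n. ennreal (h' w) * (\<integral>\<^sup>+u. ennreal (\<rho> w u) * f (w(Suc n := u)) \<partial>\<gamma>)
        = (\<integral>\<^sup>+u. ennreal (h (w(Suc n := u))) * f (w(Suc n := u)) \<partial>\<gamma>)"
        using h_eq AE_space
      proof eventually_elim
        fix w assume eq: "AE u in \<gamma>. h (w(Suc n := u)) = h' w * \<rho> w u" and w: "w \<in> space (noise \<gamma> n)"
        note [measurable] = slice[OF f w] \<rho>_meas'[OF w]
        have "(\<integral>\<^sup>+u. ennreal (h (w(Suc n := u))) * f (w(Suc n := u)) \<partial>\<gamma>)
          = (\<integral>\<^sup>+u. ennreal (h' w) * (ennreal (\<rho> w u) * f (w(Suc n := u))) \<partial>\<gamma>)"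
          by (rule nn_integral_cong_AE, use eq in eventually_elim)
             (simp add: ennreal_mult h'_nn \<rho>_nn mult.assoc)
        then show "ennreal (h' w) * (\<integral>\<^sup>+u. ennreal (\<rho> w u) * f (w(Suc n := u)) \<partial>\<gamma>)
          = (\<integral>\<^sup>+u. ennreal (h (w(Suc n := u))) * f (w(Suc n := u)) \<partial>\<gamma>)"
          by (simp add: nn_integral_cmult)
      qed
    qed
    also have "\<dots> = (\<integral>\<^sup>+w. ennreal (h w) * f w \<partial>noise \<gamma> (Suc n))"
      by (subst nn_integral_noise_Suc) auto
    finally show "(\<integral>\<^sup>+z. f (fst z) \<partial>\<pi>') = \<dots>" .
    have "(\<integral>\<^sup>+z. f (snd z) \<partial>\<pi>') =
      (\<integral>\<^sup>+z. maximal_coupling \<gamma> (\<rho> (fst z)) (\<lambda>(u, v). f ((snd z)(Suc n := v))) \<partial>\<pi>)"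
      by (subst \<pi>') auto
    \<comment> \<open>The law of \<open>v\<close> does not depend on the past, hence the second
      marginal stays a product measure.\<close>
    also have "\<dots> = (\<integral>\<^sup>+z. \<integral>\<^sup>+v. f ((snd z)(Suc n := v)) \<partial>\<gamma> \<partial>\<pi>)"
      by (intro nn_integral_cong maximal_coupling_snd \<rho>_meas' \<rho>_nn \<rho>_one slice f \<pi>_space)
    also have "\<dots> = (\<integral>\<^sup>+w. \<integral>\<^sup>+u. f (w(Suc n := u)) \<partial>\<gamma> \<partial>noise \<gamma> n)"
      by (rule \<pi>_snd[of "\<lambda>w. \<integral>\<^sup>+u. f (w(Suc n := u)) \<partial>\<gamma>"]) measurable
    also have "\<dots> = (\<integral>\<^sup>+w. f w \<partial>noise \<gamma> (Suc n))"
      by (subst nn_integral_noise_Suc) auto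
    finally show "(\<integral>\<^sup>+z. f (snd z) \<partial>\<pi>') = \<dots>" .
  next
    define c where "c = ennreal (lam * (1 + 4 * K) / del)"
    define E where "E w = (\<integral>\<^sup>+u. ennreal (ent_fun (\<rho> w u)) \<partial>\<gamma>)" for w
    have [measurable]: "E \<in> borel_measurable (noise \<gamma> n)" unfolding E_def by measurable
    have chain: "(\<integral>\<^sup>+w. ennreal (h' w) * E w \<partial>noise \<gamma> n) + (\<integral>\<^sup>+w. ennreal (ent_fun (h' w)) \<partial>noise \<gamma> n)
      = (\<integral>\<^sup>+w. ennreal (ent_fun (h w)) \<partial>noise \<gamma> (Suc n))"
    proof -
      have "(\<integral>\<^sup>+w. ennreal (h' w) * E w \<partial>noise \<gamma> n) + (\<integral>\<^sup>+w. ennreal (ent_fun (h' w)) \<partial>noise \<gamma> n)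
        = (\<integral>\<^sup>+w. ennreal (h' w) * E w + ennreal (ent_fun (h' w)) \<partial>noise \<gamma> n)"
        by (simp add: nn_integral_add)
      also have "\<dots> = (\<integral>\<^sup>+w. \<integral>\<^sup>+u. ennreal (ent_fun (h (w(Suc n := u)))) \<partial>\<gamma> \<partial>noise \<gamma> n)"
      proof (rule nn_integral_cong_AE)
        show "AE w in noise \<gamma> n. ennreal (h' w) * E w + ennreal (ent_fun (h' w)) =
          (\<integral>\<^sup>+u. ennreal (ent_fun (h (w(Suc n := u)))) \<partial>\<gamma>)"
          using h_eq AE_space
        proof eventually_elim
          fix w assume eq: "AE u in \<gamma>. h (w(Suc n := u)) = h' w * \<rho> w u" and w: "w \<in> space (noise \<gamma> n)"
          have "ennreal (h' w) * E w + ennreal (ent_fun (h' w)) = (\<integral>\<^sup>+u. ennreal (ent_fun (h' w * \<rho> w u)) \<partial>\<gamma>)"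
            unfolding E_def by (intro entropy_chain_rule \<rho>_meas' \<rho>_nn \<rho>_one h'_nn w)
          also have "\<dots> = (\<integral>\<^sup>+u. ennreal (ent_fun (h (w(Suc n := u)))) \<partial>\<gamma>)"
            by (rule nn_integral_cong_AE, use eq in eventually_elim) simp
          finally show "ennreal (h' w) * E w + ennreal (ent_fun (h' w)) = \<dots>" .
        qed
      qed
      also have "\<dots> = (\<integral>\<^sup>+w. ennreal (ent_fun (h w)) \<partial>noise \<gamma> (Suc n))"
        by (subst nn_integral_noise_Suc) auto
      finally show ?thesis .
    qed
    have "(\<integral>\<^sup>+z. potential (Suc n) x (fst z) (snd z) \<partial>\<pi>') =
      (\<integral>\<^sup>+z. maximal_coupling \<gamma> (\<rho> (fst z)) (\<lambda>(u, v). potential (Suc n) x ((fst z)(Suc n := u)) ((snd z)(Suc n := v))) \<partial>\<pi>)"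
      by (subst \<pi>') auto
    also have "\<dots> \<le> (\<integral>\<^sup>+z. potential n x (fst z) (snd z) + ennreal L * (ennreal (1 / lam) * E (fst z) + c) \<partial>\<pi>)"
      unfolding E_def c_def by (intro nn_integral_mono step_cost_le \<rho>_meas' \<rho>_nn \<rho>_one \<pi>_space lam)
    also have "\<dots> = (\<integral>\<^sup>+z. potential n x (fst z) (snd z) \<partial>\<pi>) + ennreal L * (ennreal (1 / lam) * (\<integral>\<^sup>+z. E (fst z) \<partial>\<pi>) + c)"
      by (simp add: nn_integral_add nn_integral_cmult \<pi>_mass)
    \<comment> \<open>The conditional entropies are averaged under the tilted prefix law, which is
      the weight \<open>h'\<close> in the chain rule.\<close>
    also have "(\<integral>\<^sup>+z. E (fst z) \<partial>\<pi>) = (\<integral>\<^sup>+w. ennreal (h' w) * E w \<partial>noise \<gamma> n)"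
      by (rule \<pi>_fst) measurable
    also have "(\<integral>\<^sup>+z. potential n x (fst z) (snd z) \<partial>\<pi>) + ennreal L * (ennreal (1 / lam) * \<dots> + c)
      \<le> ennreal L * (ennreal (1 / lam) * (\<integral>\<^sup>+w. ennreal (ent_fun (h' w)) \<partial>noise \<gamma> n) + of_nat n * c)
        + ennreal L * (ennreal (1 / lam) * (\<integral>\<^sup>+w. ennreal (h' w) * E w \<partial>noise \<gamma> n) + c)"
      using \<pi>_cost unfolding c_def by (rule add_right_mono)
    also have "\<dots> = ennreal L * (ennreal (1 / lam) * (\<integral>\<^sup>+w. ennreal (ent_fun (h w)) \<partial>noise \<gamma> (Suc n)) + of_nat (Suc n) * c)"
      unfolding chain[symmetric] by (simp add: distrib_left distrib_right add_ac)
    finally show "(\<integral>\<^sup>+z. potential (Suc n) x (fst z) (snd z) \<partial>\<pi>') \<le> ennreal L * (ennreal (1 / lam) *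
      (\<integral>\<^sup>+w. ennreal (ent_fun (h w)) \<partial>noise \<gamma> (Suc n)) + of_nat (Suc n) * ennreal (lam * (1 + 4 * K) / del))"
      unfolding c_def .
  qed (fact sets_\<pi>')
qed

end

section \<open>Transport inequality on the path space\<close>

definition trajectory :: "('a \<Rightarrow> 'g \<Rightarrow> 'a) \<Rightarrow> nat \<Rightarrow> 'a \<Rightarrow> (nat \<Rightarrow> 'g) \<Rightarrow> (nat \<Rightarrow> 'a)" where
  "trajectory F n x w = (\<lambda>k\<in>{1..n}. state F k x w)"

lemma measurable_trajectory:
  fixes F :: "'a::topological_space \<Rightarrow> 'g \<Rightarrow> 'a"
  assumes "(\<lambda>(x, w). F x w) \<in> borel \<Otimes>\<^sub>M \<gamma> \<rightarrow>\<^sub>M borel"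
  shows "trajectory F n x \<in> noise \<gamma> n \<rightarrow>\<^sub>M path_space n"
  unfolding trajectory_def by (rule measurable_restrict) (use measurable_state[OF assms] in auto)

lemma measurable_dist_l1:
  "(\<lambda>z. dist_l1 n (fst z) (snd z)) \<in> borel_measurable
    (path_space n \<Otimes>\<^sub>M (path_space n :: (nat \<Rightarrow> 'a::{metric_space, second_countable_topology}) measure))"
proof -
  have "(\<lambda>z. dist (fst z i) (snd z i)) \<in> borel_measurable
    (path_space n \<Otimes>\<^sub>M (path_space n :: (nat \<Rightarrow> 'a) measure))" if [simp]: "i \<in> {1..n}" for i
  proof -
    have [measurable]: "(\<lambda>w. w i) \<in> (path_space n :: (nat \<Rightarrow> 'a) measure) \<rightarrow>\<^sub>M borel"
      by (rule measurable_component_singleton[OF that])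
    show ?thesis by measurable
  qed
  then show ?thesis unfolding dist_l1_def by (rule borel_measurable_sum)
qed

text \<open>Finite entropy includes absolute continuity, and the Radon-Nikodym derivative is almost
  everywhere finite, hence can be made real. It has integral 1, so the affine part of
  \<open>ent_fun\<close> integrates to zero.\<close>

lemma relative_entropy_density:
  assumes P: "prob_space P" and Q: "prob_space Q" and sets: "sets Q = sets P"
    and fin: "relative_entropy Q P \<noteq> \<infinity>"
  obtains f where "f \<in> borel_measurable P" "\<And>x. 0 \<le> f x" "Q = density P (\<lambda>x. ennreal (f x))"
    and "relative_entropy Q P = (\<integral>\<^sup>+x. ennreal (ent_fun (f x)) \<partial>P)"
proof -
  interpret P: prob_space P by fact
  interpret Q: prob_space Q by fact
  from fin have ac: "absolutely_continuous P Q" and int: "integrable Q (entropy_density (exp 1) P Q)"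
    by (auto simp: relative_entropy_def split: if_splits)
  define f where "f x = enn2real (RN_deriv P Q x)" for x
  have [measurable]: "f \<in> borel_measurable P" unfolding f_def by measurable
  have f_nn: "0 \<le> f x" for x by (simp add: f_def)
  have "AE x in P. RN_deriv P Q x \<noteq> \<infinity>"
    by (rule P.RN_deriv_finite[OF Q.sigma_finite_measure_axioms ac sets])
  then have "AE x in P. RN_deriv P Q x = ennreal (f x)"
    by eventually_elim (simp add: f_def top.not_eq_extremum)
  then have "density P (RN_deriv P Q) = density P (\<lambda>x. ennreal (f x))"
    by (intro density_cong) auto
  then have Q_eq: "Q = density P (\<lambda>x. ennreal (f x))"
    using P.density_RN_deriv[OF ac sets] by simp
  have ed: "entropy_density (exp 1) P Q = (\<lambda>x. ln (f x))"
    by (auto simp: entropy_density_def f_def log_ln fun_eq_iff)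
  have int_ln: "integrable P (\<lambda>x. f x * ln (f x))"
    using int unfolding ed by (subst (asm) Q_eq, subst (asm) integrable_density) (auto simp: f_nn)
  have KL: "KL_divergence (exp 1) P Q = (\<integral>x. f x * ln (f x) \<partial>P)"
    unfolding KL_divergence_def ed by (subst Q_eq, subst integral_density) (auto simp: f_nn)
  have mass: "(\<integral>\<^sup>+x. ennreal (f x) \<partial>P) = 1"
  proof -
    have "emeasure Q (space Q) = (\<integral>\<^sup>+x. ennreal (f x) * indicator (space P) x \<partial>P)"
      by (subst (1) Q_eq, subst emeasure_density) (auto simp: sets_eq_imp_space_eq[OF sets])
    also have "\<dots> = (\<integral>\<^sup>+x. ennreal (f x) \<partial>P)" by (intro nn_integral_cong) auto
    finally show ?thesis using Q.emeasure_space_1 by simp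
  qed
  then have int_f: "integrable P f" and int_one: "(\<integral>x. f x \<partial>P) = 1"
    by (auto intro!: integrableI_nonneg simp: f_nn integral_eq_nn_integral)
  have "(\<integral>\<^sup>+x. ennreal (ent_fun (f x)) \<partial>P) = ennreal (\<integral>x. ent_fun (f x) \<partial>P)"
    using int_ln int_f f_nn ent_fun_nonneg by (intro nn_integral_eq_integral) (auto simp: ent_fun_def)
  also have "(\<integral>x. ent_fun (f x) \<partial>P) = (\<integral>x. f x * ln (f x) \<partial>P)"
    unfolding ent_fun_def using int_ln int_f by (simp add: int_one P.prob_space)
  finally have "relative_entropy Q P = (\<integral>\<^sup>+x. ennreal (ent_fun (f x)) \<partial>P)"
    using ac int by (simp add: relative_entropy_def KL)
  with Q_eq f_nn show thesis by (intro that[of f]) auto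
qed

text \<open>For \<open>H > 0\<close> the two terms are balanced by the choice of \<open>lam\<close>.
  For \<open>H = 0\<close> no \<open>lam\<close> is optimal, and \<open>lam\<close> tends to 0
  instead.\<close>

lemma le_sqrt_from_linear_bounds:
  fixes H :: real and c L :: real and n :: nat
  assumes bound: "\<And>lam. lam > 0 \<Longrightarrow> w \<le> ennreal (L * (H / lam + n * (lam * c)))"
    and H: "0 \<le> H" and c: "0 < c" and L: "0 < L" and n: "n \<ge> 1"
  shows "w \<le> ennreal (sqrt (4 * L\<^sup>2 * c * n * H))"
proof (cases "H = 0")
  case True
  have "w \<le> 0"
  proof (rule ennreal_le_epsilon)
    fix e :: real assume e: "0 < e"
    \<comment> \<open>This \<open>lam\<close> makes the remaining term equal to
      \<open>e\<close>.\<close>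
    have "w \<le> ennreal (L * (H / (e / (L * n * c)) + n * (e / (L * n * c) * c)))"
      by (rule bound) (use e L c n in simp)
    then show "w \<le> 0 + ennreal e" using True L c n by simp
  qed
  then show ?thesis by simp
next
  case False
  with H have H: "H > 0" by simp
  \<comment> \<open>The solution of \<open>H / lam = n * (lam * c)\<close>.\<close>
  define lam where "lam = sqrt (H / (n * c))"
  have lam: "lam > 0" using H c n by (simp add: lam_def)
  have "lam\<^sup>2 = H / (n * c)" using H c by (simp add: lam_def)
  then have H_eq: "H = n * c * lam\<^sup>2" using c n by (simp add: field_simps)
  have "L * (H / lam + n * (lam * c)) = 2 * L * n * c * lam"
    unfolding H_eq using lam by (simp add: field_simps power2_eq_square)
  also have "\<dots> = sqrt ((2 * L * n * c * lam)\<^sup>2)" using L c lam by simp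
  also have "(2 * L * n * c * lam)\<^sup>2 = 4 * L\<^sup>2 * c * n * H"
    unfolding H_eq by (simp add: power2_eq_square)
  finally show ?thesis using bound[OF lam] by simp
qed

context dissipative_rds
begin

definition path_measure :: "nat \<Rightarrow> 'a \<Rightarrow> (nat \<Rightarrow> 'a) measure" where
  "path_measure n x = distr (noise \<gamma> n) (path_space n) (trajectory F n x)"

text \<open>The pulled-back density \<open>h\<close> tilts the noise so that its trajectories have
  law \<open>Q\<close>, and composition with the trajectory map preserves the entropy integral. A
  coupling of the noises is pushed forward to paths; the trajectory map need not be
  injective.\<close>

lemma wasserstein_le:
  assumes f [measurable]: "f \<in> borel_measurable (path_measure n x)" and nn: "\<And>y. 0 \<le> f y"
    and Q: "Q = density (path_measure n x) (\<lambda>y. ennreal (f y))" and Q_prob: "prob_space Q" and lam: "lam > 0"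
  shows "wasserstein1 (dist_l1 n) Q (path_measure n x) \<le> ennreal L * (ennreal (1 / lam) *
    (\<integral>\<^sup>+y. ennreal (ent_fun (f y)) \<partial>path_measure n x) + of_nat n * ennreal (lam * (1 + 4 * K) / del))"
proof -
  let ?P = "path_measure n x"
  note traj [measurable] = measurable_trajectory[OF F_meas, of n x]
  have sets_P [measurable_cong]: "sets ?P = sets (path_space n)" by (simp add: path_measure_def)
  have sets_Q: "sets Q = sets (path_space n)" by (simp add: Q sets_P)
  have f' [measurable]: "f \<in> borel_measurable (path_space n)" using f by (simp add: path_measure_def)
  define h where "h w = f (trajectory F n x w)" for w
  have h_meas [measurable]: "h \<in> borel_measurable (noise \<gamma> n)" unfolding h_def by measurable
  have pull: "(\<integral>\<^sup>+y. k y \<partial>?P) = (\<integral>\<^sup>+w. k (trajectory F n x w) \<partial>noise \<gamma> n)"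
    if "k \<in> borel_measurable (path_space n)" for k :: "_ \<Rightarrow> ennreal"
    unfolding path_measure_def by (rule nn_integral_distr[OF traj]) (use that in simp)
  have integral_Q: "(\<integral>\<^sup>+y. k y \<partial>Q) = (\<integral>\<^sup>+w. ennreal (h w) * k (trajectory F n x w) \<partial>noise \<gamma> n)"
    if [measurable]: "k \<in> borel_measurable (path_space n)" for k :: "_ \<Rightarrow> ennreal"
  proof -
    have "(\<integral>\<^sup>+y. k y \<partial>Q) = (\<integral>\<^sup>+y. ennreal (f y) * k y \<partial>?P)"
      unfolding Q by (rule nn_integral_density) measurable
    also have "\<dots> = (\<integral>\<^sup>+w. ennreal (h w) * k (trajectory F n x w) \<partial>noise \<gamma> n)"
      unfolding h_def by (rule pull) measurable
    finally show ?thesis .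
  qed
  have h_one: "(\<integral>\<^sup>+w. ennreal (h w) \<partial>noise \<gamma> n) = 1"
    using integral_Q[of "\<lambda>_. 1"] prob_space.emeasure_space_1[OF Q_prob] by simp
  obtain \<pi> where "entropic_coupling n x lam h \<pi>"
    using exists_entropic_coupling[OF h_meas _ h_one lam] nn unfolding h_def by blast
  then have sets_\<pi> [measurable_cong]: "sets \<pi> = sets (noise \<gamma> n \<Otimes>\<^sub>M noise \<gamma> n)"
    and \<pi>_fst: "\<And>f. f \<in> borel_measurable (noise \<gamma> n) \<Longrightarrow> (\<integral>\<^sup>+z. f (fst z) \<partial>\<pi>) = (\<integral>\<^sup>+w. ennreal (h w) * f w \<partial>noise \<gamma> n)"
    and \<pi>_snd: "\<And>f. f \<in> borel_measurable (noise \<gamma> n) \<Longrightarrow> (\<integral>\<^sup>+z. f (snd z) \<partial>\<pi>) = (\<integral>\<^sup>+w. f w \<partial>noise \<gamma> n)"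
    and \<pi>_cost: "(\<integral>\<^sup>+z. potential n x (fst z) (snd z) \<partial>\<pi>) \<le> ennreal L * (ennreal (1 / lam) *
      (\<integral>\<^sup>+w. ennreal (ent_fun (h w)) \<partial>noise \<gamma> n) + of_nat n * ennreal (lam * (1 + 4 * K) / del))"
    unfolding entropic_coupling_def by blast+
  define both where "both z = (trajectory F n x (fst z), trajectory F n x (snd z))" for z
  have both [measurable]: "both \<in> \<pi> \<rightarrow>\<^sub>M path_space n \<Otimes>\<^sub>M path_space n"
    unfolding both_def by measurable
  define \<pi>' where "\<pi>' = distr \<pi> (path_space n \<Otimes>\<^sub>M path_space n) both"
  have \<pi>': "(\<integral>\<^sup>+z. k z \<partial>\<pi>') = (\<integral>\<^sup>+z. k (both z) \<partial>\<pi>)"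
    if "k \<in> borel_measurable (path_space n \<Otimes>\<^sub>M path_space n)" for k :: "_ \<Rightarrow> ennreal"
    unfolding \<pi>'_def by (rule nn_integral_distr[OF both]) (use that in simp)
  have sets_\<pi>' [measurable_cong]: "sets \<pi>' = sets (path_space n \<Otimes>\<^sub>M path_space n)" by (simp add: \<pi>'_def)
  have ind: "(\<lambda>w. indicator B (trajectory F n x w) :: ennreal) \<in> borel_measurable (noise \<gamma> n)"
    if [measurable]: "B \<in> sets (path_space n)" for B by measurable
  \<comment> \<open>Both projections of the pushed-forward coupling are identified in the same way,
    by comparing integrals of indicators.\<close>
  have marginal: "distr \<pi>' N p = N"
    if N: "sets N = sets (path_space n)" and p [measurable]: "p \<in> path_space n \<Otimes>\<^sub>M path_space n \<rightarrow>\<^sub>M path_space n"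
      and eq: "\<And>B. B \<in> sets (path_space n) \<Longrightarrow>
        (\<integral>\<^sup>+z. indicator B (p (both z)) \<partial>\<pi>) = (\<integral>\<^sup>+y. indicator B y \<partial>N)" for N p
  proof (rule measure_eqI)
    fix B assume "B \<in> sets (distr \<pi>' N p)"
    then have B [measurable]: "B \<in> sets (path_space n)" and BN: "B \<in> sets N" by (simp_all add: N)
    have pN: "p \<in> \<pi>' \<rightarrow>\<^sub>M N" using p by (simp add: measurable_cong_sets[OF sets_\<pi>' N])
    have "emeasure (distr \<pi>' N p) B = (\<integral>\<^sup>+y. indicator B y \<partial>distr \<pi>' N p)"
      using BN by simp
    also have "\<dots> = (\<integral>\<^sup>+z. indicator B (p z) \<partial>\<pi>')"
      by (rule nn_integral_distr[OF pN]) (use BN in simp)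
    also have "\<dots> = (\<integral>\<^sup>+z. indicator B (p (both z)) \<partial>\<pi>)" by (rule \<pi>') measurable
    also have "\<dots> = (\<integral>\<^sup>+y. indicator B y \<partial>N)" by (rule eq[OF B])
    also have "\<dots> = emeasure N B" using BN by simp
    finally show "emeasure (distr \<pi>' N p) B = emeasure N B" .
  qed simp
  have "distr \<pi>' Q fst = Q"
  proof (rule marginal[OF sets_Q])
    fix B :: "(nat \<Rightarrow> 'a) set" assume B [measurable]: "B \<in> sets (path_space n)"
    show "(\<integral>\<^sup>+z. indicator B (fst (both z)) \<partial>\<pi>) = (\<integral>\<^sup>+y. indicator B y \<partial>Q)"
      using \<pi>_fst[OF ind[OF B]] integral_Q[OF borel_measurable_indicator[OF B]] by (simp add: both_def)
  qed measurable
  moreover have "distr \<pi>' ?P snd = ?P"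
  proof (rule marginal[OF sets_P])
    fix B :: "(nat \<Rightarrow> 'a) set" assume B [measurable]: "B \<in> sets (path_space n)"
    show "(\<integral>\<^sup>+z. indicator B (snd (both z)) \<partial>\<pi>) = (\<integral>\<^sup>+y. indicator B y \<partial>?P)"
      using \<pi>_snd[OF ind[OF B]] pull[OF borel_measurable_indicator[OF B]] by (simp add: both_def)
  qed measurable
  moreover have "sets \<pi>' = sets (Q \<Otimes>\<^sub>M ?P)"
    unfolding sets_\<pi>' by (rule sets_pair_measure_cong) (simp_all add: sets_Q sets_P)
  ultimately have "\<pi>' \<in> couplings Q ?P" by (simp add: couplings_def)
  then have "wasserstein1 (dist_l1 n) Q ?P \<le> (\<integral>\<^sup>+z. ennreal (dist_l1 n (fst z) (snd z)) \<partial>\<pi>')"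
    unfolding wasserstein1_def by (rule INF_lower)
  also have "\<dots> = (\<integral>\<^sup>+z. ennreal (dist_l1 n (fst (both z)) (snd (both z))) \<partial>\<pi>)"
    by (rule \<pi>') (intro measurable_compose[OF measurable_dist_l1 measurable_ennreal])
  also have "\<dots> \<le> (\<integral>\<^sup>+z. potential n x (fst z) (snd z) \<partial>\<pi>)"
    using dist_l1_le_potential by (intro nn_integral_mono) (simp add: both_def trajectory_def)
  also note \<pi>_cost
  also have "(\<integral>\<^sup>+w. ennreal (ent_fun (h w)) \<partial>noise \<gamma> n) = (\<integral>\<^sup>+y. ennreal (ent_fun (f y)) \<partial>?P)"
    unfolding h_def by (rule pull[symmetric]) measurable
  finally show ?thesis .
qed

lemma transport_entropy_inequality:
  assumes n: "n \<ge> 1" and Q: "prob_space Q" and sets_Q: "sets Q = sets (path_space n)"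
  shows "wasserstein1 (dist_l1 n) Q (path_measure n x) \<le>
    ennreal_sqrt (ennreal (4 * L\<^sup>2 * ((1 + 4 * K) / del)) * of_nat n * relative_entropy Q (path_measure n x))"
proof -
  let ?P = "path_measure n x"
  define c where "c = (1 + 4 * K) / del"
  have c: "c > 0" using K_nn del_pos by (simp add: c_def)
  have P: "prob_space ?P"
    unfolding path_measure_def
    by (rule prob_space.prob_space_distr[OF prob_space_noise measurable_trajectory[OF F_meas]])
  have C: "4 * L\<^sup>2 * c > 0" using c L_pos by simp
  show ?thesis
  proof (cases "relative_entropy Q ?P = \<infinity>")
    case True
    \<comment> \<open>The right-hand side is infinite, because the constant and \<open>n\<close> are
      positive.\<close>
    then show ?thesis
      using c L_pos n by (simp add: ennreal_sqrt_def c_def[symmetric] ennreal_mult_top ennreal_mult_eq_top_iff)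
  next
    case False
    have sets: "sets Q = sets ?P" using sets_Q by (simp add: path_measure_def)
    obtain f where f: "f \<in> borel_measurable ?P" "\<And>y. 0 \<le> f y" "Q = density ?P (\<lambda>y. ennreal (f y))"
      and ent: "relative_entropy Q ?P = (\<integral>\<^sup>+y. ennreal (ent_fun (f y)) \<partial>?P)"
      using relative_entropy_density[OF P Q sets False] by blast
    obtain H where H: "0 \<le> H" "relative_entropy Q ?P = ennreal H"
      using False by (cases "relative_entropy Q ?P") auto
    have "wasserstein1 (dist_l1 n) Q ?P \<le> ennreal (L * (H / lam + n * (lam * c)))" if lam: "lam > 0" for lam
    proof -
      have "wasserstein1 (dist_l1 n) Q ?P \<le> ennreal L * (ennreal (1 / lam) * ennreal H + of_nat n * ennreal (lam * c))"
        using wasserstein_le[OF f Q lam] unfolding ent[symmetric] H(2) by (simp add: c_def)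
      also have "\<dots> = ennreal (L * (H / lam + n * (lam * c)))"
        using H(1) lam c L_pos
        by (simp add: ennreal_mult[symmetric] ennreal_plus[symmetric] ennreal_of_nat_eq_real_of_nat del: ennreal_plus)
      finally show ?thesis .
    qed
    then have "wasserstein1 (dist_l1 n) Q ?P \<le> ennreal (sqrt (4 * L\<^sup>2 * c * n * H))"
      by (rule le_sqrt_from_linear_bounds) (use H c L_pos n in auto)
    also have "\<dots> = ennreal_sqrt (ennreal (4 * L\<^sup>2 * c) * of_nat n * relative_entropy Q ?P)"
      using H C by (simp add: ennreal_sqrt_def ennreal_of_nat_eq_real_of_nat ennreal_mult[symmetric])
    finally show ?thesis by (simp add: c_def)
  qed
qed

end

section \<open>Lyapunov functions\<close>

text \<open>The expected distance after \<open>j\<close> synchronous steps, computed by conditioning on the first step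
  (\<^const>\<open>rds\<close> appends the last one).\<close>

primrec separation :: "'g measure \<Rightarrow> ('a::metric_space \<Rightarrow> 'g \<Rightarrow> 'a) \<Rightarrow> nat \<Rightarrow> 'a \<Rightarrow> 'a \<Rightarrow> ennreal" where
  "separation \<gamma> F 0 x y = ennreal (dist x y)"
| "separation \<gamma> F (Suc j) x y = (\<integral>\<^sup>+w. separation \<gamma> F j (F x w) (F y w) \<partial>\<gamma>)"

context prob_space
begin

context
  fixes F :: "'b::{metric_space, second_countable_topology} \<Rightarrow> 'a \<Rightarrow> 'b"
  assumes F [measurable]: "(\<lambda>(x, w). F x w) \<in> borel \<Otimes>\<^sub>M M \<rightarrow>\<^sub>M borel"
begin

lemma measurable_separation [measurable]:
  "(\<lambda>(x, y). separation M F j x y) \<in> borel_measurable (borel \<Otimes>\<^sub>M borel)"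
proof (induction j)
  case (Suc j)
  note [measurable] = Suc
  show ?case unfolding separation.simps by measurable
qed simp

lemma separation_triangle: "separation M F j x z \<le> separation M F j x y + separation M F j y z"
proof (induction j arbitrary: x y z)
  case 0
  then show ?case
    using dist_triangle[of x z y] by (simp add: ennreal_plus[symmetric] ennreal_leI del: ennreal_plus)
next
  case (Suc j)
  have "separation M F (Suc j) x z \<le> (\<integral>\<^sup>+w. separation M F j (F x w) (F y w) + separation M F j (F y w) (F z w) \<partial>M)"
    unfolding separation.simps by (intro nn_integral_mono Suc)
  also have "\<dots> = separation M F (Suc j) x y + separation M F (Suc j) y z"
    unfolding separation.simps by (rule nn_integral_add) measurable
  finally show ?case .
qed

text \<open>\<open>separation\<close> peels off the first step and \<open>state\<close> the last.
  Integrating out the newest coordinate raises the index of \<open>separation\<close> by one, whence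
  the general \<open>i\<close>; with \<open>i = 0\<close> this gives the expected distance at time
  \<open>n\<close>.\<close>

lemma separation_state:
  "(\<integral>\<^sup>+w. separation M F i (state F n x w) (state F n y w) \<partial>noise M n) = separation M F (i + n) x y"
proof (induction n arbitrary: i)
  case 0
  interpret N: prob_space "noise M 0" by (rule prob_space_noise)
  show ?case by (simp add: N.emeasure_space_1[simplified])
next
  case (Suc n)
  have [measurable]: "state F (Suc n) z \<in> noise M (Suc n) \<rightarrow>\<^sub>M borel" for z
    by (rule measurable_state[OF F order_refl])
  have "(\<integral>\<^sup>+w. separation M F i (state F (Suc n) x w) (state F (Suc n) y w) \<partial>noise M (Suc n))
    = (\<integral>\<^sup>+w. \<integral>\<^sup>+u. separation M F i (state F (Suc n) x (w(Suc n := u))) (state F (Suc n) y (w(Suc n := u))) \<partial>M \<partial>noise M n)"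
    by (rule nn_integral_noise_Suc) measurable
  also have "\<dots> = (\<integral>\<^sup>+w. separation M F (Suc i) (state F n x w) (state F n y w) \<partial>noise M n)"
    by (simp add: state_upd)
  also have "\<dots> = separation M F (i + Suc n) x y" by (simp only: Suc add_Suc_shift)
  finally show ?case .
qed

end
end

text \<open>The factor \<open>1 / (1 - r)\<close> is the sum of the geometric series that bounds all
  future distances; the decrease of \<open>V\<close> is the identity
  \<open>s * r + 1 = s\<close>.\<close>

lemma (in prob_space) dissipative_rds_of_contraction:
  fixes F :: "'b::{metric_space, second_countable_topology} \<Rightarrow> 'a \<Rightarrow> 'b"
  assumes F [measurable]: "(\<lambda>(x, w). F x w) \<in> borel \<Otimes>\<^sub>M M \<rightarrow>\<^sub>M borel"
    and r: "0 \<le> r" "r < 1"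
    and contr: "\<And>x y. (\<integral>\<^sup>+w. ennreal (dist (F x w) (F y w)) \<partial>M) \<le> ennreal (r * dist x y)"
    and "0 < del" "0 \<le> K"
    and "\<And>x. (\<integral>\<^sup>+u. \<integral>\<^sup>+v. ennreal (exp (del * (dist (F x u) (F x v))\<^sup>2)) \<partial>M \<partial>M) \<le> ennreal K"
  shows "dissipative_rds M F (\<lambda>x y. ennreal (1 / (1 - r) * dist x y)) (1 / (1 - r)) del K"
proof
  define s where "s = 1 / (1 - r)"
  have s: "s \<ge> 1" "s * r + 1 = s" using r by (auto simp: s_def field_simps)
  show "0 < 1 / (1 - r)" using r by simp
  fix x y z :: 'b
  show "(\<lambda>(x, y). ennreal (1 / (1 - r) * dist x y)) \<in> borel_measurable (borel \<Otimes>\<^sub>M (borel :: 'b measure))"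
    by measurable
  show "ennreal (1 / (1 - r) * dist x z) \<le> ennreal (1 / (1 - r) * dist x y) + ennreal (1 / (1 - r) * dist y z)"
    unfolding s_def[symmetric] using s mult_left_mono[OF dist_triangle[of x z y], of s]
    by (simp add: ennreal_plus[symmetric] distrib_left ennreal_leI del: ennreal_plus)
  show "ennreal (dist x y) \<le> ennreal (1 / (1 - r) * dist x y)"
    unfolding s_def[symmetric] using mult_right_mono[OF s(1), of "dist x y"] by (simp add: ennreal_leI)
  have "(\<integral>\<^sup>+w. ennreal (s * dist (F x w) (F y w)) \<partial>M) = ennreal s * (\<integral>\<^sup>+w. ennreal (dist (F x w) (F y w)) \<partial>M)"
    using s by (simp add: ennreal_mult nn_integral_cmult)
  also have "\<dots> \<le> ennreal s * ennreal (r * dist x y)"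
    by (intro mult_left_mono contr) simp
  also have "\<dots> + ennreal (dist x y) = ennreal ((s * r + 1) * dist x y)"
    using s(1) r by (simp add: ennreal_mult[symmetric] ennreal_plus[symmetric] algebra_simps del: ennreal_plus)
  finally show "(\<integral>\<^sup>+w. ennreal (1 / (1 - r) * dist (F x w) (F y w)) \<partial>M) + ennreal (dist x y)
      \<le> ennreal (1 / (1 - r) * dist x y)"
    unfolding s_def[symmetric] s(2) by (simp add: add_right_mono)
qed (use assms in auto)

text \<open>With \<open>V\<close> the series of all expected distances, one synchronous step shifts
  the series by one index, and the lost term is exactly the distance. That term at index 0 also
  accounts for the 1 in \<open>1 + S\<close>.\<close>

lemma (in prob_space) dissipative_rds_of_summable:
  fixes F :: "'b::{metric_space, second_countable_topology} \<Rightarrow> 'a \<Rightarrow> 'b"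
  assumes F [measurable]: "(\<lambda>(x, w). F x w) \<in> borel \<Otimes>\<^sub>M M \<rightarrow>\<^sub>M borel"
    and S: "0 \<le> S"
    and summ: "\<And>x y. (\<Sum>j. separation M F (Suc j) x y) \<le> ennreal (S * dist x y)"
    and "0 < del" "0 \<le> K"
    and "\<And>x. (\<integral>\<^sup>+u. \<integral>\<^sup>+v. ennreal (exp (del * (dist (F x u) (F x v))\<^sup>2)) \<partial>M \<partial>M) \<le> ennreal K"
  shows "dissipative_rds M F (\<lambda>x y. \<Sum>j. separation M F j x y) (1 + S) del K"
proof
  show "0 < 1 + S" using S by simp
  fix x y z :: 'b
  have split: "(\<Sum>j. separation M F j x y) = (\<Sum>j. separation M F (Suc j) x y) + ennreal (dist x y)" for x y
    using suminf_offset[of "\<lambda>j. separation M F j x y" 1] by simp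
  note [measurable] = measurable_separation[OF F]
  show "(\<lambda>(x, y). \<Sum>j. separation M F j x y) \<in> borel_measurable (borel \<Otimes>\<^sub>M (borel :: 'b measure))"
    by measurable
  have "(\<Sum>j. separation M F j x z) \<le> (\<Sum>j. separation M F j x y + separation M F j y z)"
    by (intro suminf_le separation_triangle F summableI)
  also have "\<dots> = (\<Sum>j. separation M F j x y) + (\<Sum>j. separation M F j y z)"
    by (rule suminf_add[symmetric]) auto
  finally show "(\<Sum>j. separation M F j x z) \<le> \<dots>" .
  show "ennreal (dist x y) \<le> (\<Sum>j. separation M F j x y)" unfolding split by simp
  have "(\<Sum>j. separation M F j x y) \<le> ennreal (S * dist x y) + ennreal (dist x y)"
    unfolding split by (intro add_right_mono summ)
  also have "\<dots> = ennreal ((1 + S) * dist x y)"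
    using S by (simp add: ennreal_plus[symmetric] algebra_simps del: ennreal_plus)
  finally show "(\<Sum>j. separation M F j x y) \<le> ennreal ((1 + S) * dist x y)" .
  have "(\<integral>\<^sup>+w. (\<Sum>j. separation M F j (F x w) (F y w)) \<partial>M) = (\<Sum>j. separation M F (Suc j) x y)"
    unfolding separation.simps by (rule nn_integral_suminf) measurable
  then show "(\<integral>\<^sup>+w. (\<Sum>j. separation M F j (F x w) (F y w)) \<partial>M) + ennreal (dist x y) \<le> (\<Sum>j. separation M F j x y)"
    unfolding split by simp
qed (use assms in auto)

section \<open>Transfer from the given random variables to the canonical noise\<close>

lemma rds_eq_state: "rds F W n x \<omega> = state F n x (\<lambda>k. W k \<omega>)"
  by (induction n) auto

text \<open>Independence identifies the joint law with the product of the laws, all equal to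
  \<open>\<gamma>\<close>; \<open>n \<ge> 1\<close> makes the index set nonempty for this
  characterisation.\<close>

lemma (in prob_space) distr_noise:
  assumes indep: "indep_vars (\<lambda>_. G) W UNIV" and ident: "\<And>n. distr M G (W n) = \<gamma>" and n: "n \<ge> 1"
  shows "(\<lambda>\<omega>. \<lambda>i\<in>{Suc 0..n}. W i \<omega>) \<in> M \<rightarrow>\<^sub>M noise \<gamma> n"
    and "distr M (noise \<gamma> n) (\<lambda>\<omega>. \<lambda>i\<in>{Suc 0..n::nat}. W i \<omega>) = noise \<gamma> n"
proof -
  have rv: "random_variable G (W i)" for i
    using indep by (auto simp: indep_vars_def)
  have sets_\<gamma>: "sets \<gamma> = sets G" using ident[of 0] by (metis sets_distr)
  have sets_noise: "sets (noise \<gamma> n) = sets (noise G n)"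
    by (intro sets_PiM_cong sets_\<gamma> refl)
  have "(\<lambda>\<omega>. \<lambda>i\<in>{Suc 0..n}. W i \<omega>) \<in> M \<rightarrow>\<^sub>M noise G n"
    by (intro measurable_restrict rv)
  then show "(\<lambda>\<omega>. \<lambda>i\<in>{Suc 0..n}. W i \<omega>) \<in> M \<rightarrow>\<^sub>M noise \<gamma> n"
    by (simp add: measurable_cong_sets[OF refl sets_noise])
  have "indep_vars (\<lambda>_. G) W {Suc 0..n}" by (rule indep_vars_subset[OF indep]) simp
  then have "distr M (noise G n) (\<lambda>\<omega>. \<lambda>i\<in>{Suc 0..n}. W i \<omega>) = (\<Pi>\<^sub>M i\<in>{Suc 0..n}. distr M G (W i))"
    using n by (subst (asm) indep_vars_iff_distr_eq_PiM) (auto simp: rv)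
  then show "distr M (noise \<gamma> n) (\<lambda>\<omega>. \<lambda>i\<in>{Suc 0..n}. W i \<omega>) = noise \<gamma> n"
    using sets_noise by (simp add: ident cong: distr_cong)
qed

theorem proposition3p1:
  fixes A :: "('a::{metric_space, second_countable_topology}, 'b::real_normed_vector) chart set"
    and g :: "('a, 'b) chart \<Rightarrow> 'a \<Rightarrow> 'b \<Rightarrow> 'b \<Rightarrow> real"
    and M :: "'w measure"
    and G :: "'g measure"
    and W :: "nat \<Rightarrow> 'w \<Rightarrow> 'g"
    and F :: "'a \<Rightarrow> 'g \<Rightarrow> 'a"
  assumes manifold: "complete_connected_riemannian_manifold A g"
    and prob: "prob_space M"
    and W_indep: "prob_space.indep_vars M (\<lambda>_. G) W UNIV"
    and W_ident: "\<And>n. distr M G (W n) = distr M G (W 0)"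
    and F_meas: "(\<lambda>(x, w). F x w) \<in> borel \<Otimes>\<^sub>M G \<rightarrow>\<^sub>M borel"
    and exp_int: "\<exists>\<delta>>0. (SUP x. \<integral>\<^sup>+\<omega>. ennreal (exp (\<delta> * (dist (F x (W 1 \<omega>)) (F x (W 2 \<omega>)))\<^sup>2)) \<partial>M) < \<infinity>"
    and contraction:
      "(\<exists>r. 0 \<le> r \<and> r < 1 \<and>
          (\<forall>x x'. (\<integral>\<^sup>+\<omega>. ennreal (dist (F x (W 1 \<omega>)) (F x' (W 1 \<omega>))) \<partial>M) \<le> ennreal (r * dist x x')))
       \<or> (\<exists>S\<ge>0. \<forall>x x'.
          (\<Sum>n. \<integral>\<^sup>+\<omega>. ennreal (dist (rds F W (Suc n) x \<omega>) (rds F W (Suc n) x' \<omega>)) \<partial>M)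
            \<le> ennreal (S * dist x x'))"
  shows "\<exists>C>0. \<forall>x. \<forall>n\<ge>1. \<forall>Q.
    prob_space Q \<and> sets Q = sets (path_space n :: (nat \<Rightarrow> 'a) measure) \<longrightarrow>
      wasserstein1 (dist_l1 n) Q (path_law M F W n x)
        \<le> ennreal_sqrt (ennreal C * of_nat n * relative_entropy Q (path_law M F W n x))"
proof -
  interpret M: prob_space M by (rule prob)
  define \<gamma> where "\<gamma> = distr M G (W 0)"
  have rv: "W i \<in> M \<rightarrow>\<^sub>M G" for i using W_indep by (auto simp: M.indep_vars_def)
  have W_law: "distr M G (W i) = \<gamma>" for i using W_ident by (simp add: \<gamma>_def)
  interpret \<gamma>: prob_space \<gamma> unfolding \<gamma>_def by (rule M.prob_space_distr[OF rv])
  have sets_\<gamma> [measurable_cong]: "sets \<gamma> = sets G" by (simp add: \<gamma>_def)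
  have F [measurable]: "(\<lambda>(x, w). F x w) \<in> borel \<Otimes>\<^sub>M \<gamma> \<rightarrow>\<^sub>M borel"
    using F_meas by (simp add: measurable_cong_sets[OF sets_pair_measure_cong[OF refl sets_\<gamma>] refl])
  note law = M.distr_noise[OF W_indep W_law]
  have pull: "(\<integral>\<^sup>+\<omega>. f (\<lambda>i\<in>{Suc 0..n}. W i \<omega>) \<partial>M) = (\<integral>\<^sup>+w. f w \<partial>noise \<gamma> n)"
    if "n \<ge> 1" "f \<in> borel_measurable (noise \<gamma> n)" for f n
    using nn_integral_distr[OF law(1)[OF that(1)], of f] that law(2)[OF that(1)] by simp
  obtain \<delta> where \<delta>: "\<delta> > 0"
    and sup: "(SUP x. \<integral>\<^sup>+\<omega>. ennreal (exp (\<delta> * (dist (F x (W 1 \<omega>)) (F x (W 2 \<omega>)))\<^sup>2)) \<partial>M) < \<infinity>"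
    using exp_int by blast
  define K where "K = enn2real (SUP x. \<integral>\<^sup>+\<omega>. ennreal (exp (\<delta> * (dist (F x (W 1 \<omega>)) (F x (W 2 \<omega>)))\<^sup>2)) \<partial>M)"
  have K: "0 \<le> K" by (simp add: K_def)
  \<comment> \<open>\<open>W 1\<close> and \<open>W 2\<close> are independent with law
    \<open>\<gamma>\<close>, so the iterated integral is an expectation below the supremum, which is
    finite and hence equal to \<open>ennreal K\<close>.\<close>
  have exp_le: "(\<integral>\<^sup>+u. \<integral>\<^sup>+v. ennreal (exp (\<delta> * (dist (F x u) (F x v))\<^sup>2)) \<partial>\<gamma> \<partial>\<gamma>) \<le> ennreal K" for x
  proof -
    interpret P: product_sigma_finite "\<lambda>_::nat. \<gamma>" by unfold_locales
    define e where "e u v = ennreal (exp (\<delta> * (dist (F x u) (F x v))\<^sup>2))" for u v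
    have e [measurable]: "case_prod e \<in> borel_measurable (\<gamma> \<Otimes>\<^sub>M \<gamma>)" unfolding e_def by measurable
    have two: "{Suc 0..2} = {1, 2::nat}" by auto
    have "(\<lambda>w. w 1) \<in> noise \<gamma> 2 \<rightarrow>\<^sub>M \<gamma>" "(\<lambda>w. w 2) \<in> noise \<gamma> 2 \<rightarrow>\<^sub>M \<gamma>"
      unfolding two by (auto intro: measurable_component_singleton)
    from measurable_compose[OF measurable_Pair[OF this] e]
    have e_meas: "(\<lambda>w. e (w 1) (w 2)) \<in> borel_measurable (noise \<gamma> 2)" by simp
    have "(\<integral>\<^sup>+u. \<integral>\<^sup>+v. e u v \<partial>\<gamma> \<partial>\<gamma>) = (\<integral>\<^sup>+z. e (fst z) (snd z) \<partial>(\<gamma> \<Otimes>\<^sub>M \<gamma>))"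
      using \<gamma>.nn_integral_fst[OF e] by (simp add: split_beta')
    also have "\<dots> = (\<integral>\<^sup>+w. e (w 1) (w 2) \<partial>noise \<gamma> 2)"
      unfolding two by (rule P.product_nn_integral_pair[symmetric]) (use e in auto)
    also have "\<dots> = (\<integral>\<^sup>+\<omega>. e (W 1 \<omega>) (W 2 \<omega>) \<partial>M)"
      using pull[OF one_le_numeral e_meas] by simp
    also have "\<dots> \<le> (SUP x. \<integral>\<^sup>+\<omega>. ennreal (exp (\<delta> * (dist (F x (W 1 \<omega>)) (F x (W 2 \<omega>)))\<^sup>2)) \<partial>M)"
      unfolding e_def by (rule SUP_upper) simp
    also have "\<dots> = ennreal K" unfolding K_def using sup by simp
    finally show ?thesis unfolding e_def .
  qed
  have sep: "(\<integral>\<^sup>+\<omega>. ennreal (dist (rds F W (Suc n) x \<omega>) (rds F W (Suc n) y \<omega>)) \<partial>M) = separation \<gamma> F (Suc n) x y"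
    for n x y
  proof -
    have [measurable]: "state F (Suc n) z \<in> noise \<gamma> (Suc n) \<rightarrow>\<^sub>M borel" for z
      by (rule measurable_state[OF F order_refl])
    have eq: "rds F W (Suc n) z \<omega> = state F (Suc n) z (\<lambda>i\<in>{Suc 0..Suc n}. W i \<omega>)" for z \<omega>
      by (subst rds_eq_state, rule state_cong) auto
    have "(\<integral>\<^sup>+\<omega>. ennreal (dist (rds F W (Suc n) x \<omega>) (rds F W (Suc n) y \<omega>)) \<partial>M)
      = (\<integral>\<^sup>+w. ennreal (dist (state F (Suc n) x w) (state F (Suc n) y w)) \<partial>noise \<gamma> (Suc n))"
      unfolding eq by (rule pull) (simp, measurable)
    also have "\<dots> = separation \<gamma> F (Suc n) x y"
      using \<gamma>.separation_state[OF F, where i = 0 and n = "Suc n" and x = x and y = y]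
      unfolding separation.simps(1) add_0_left .
    finally show ?thesis .
  qed
  \<comment> \<open>The two alternatives differ only in the Lyapunov function and its constant
    \<open>L\<close>.\<close>
  have "\<exists>V L. dissipative_rds \<gamma> F V L \<delta> K"
    using contraction
  proof (elim disjE exE conjE)
    fix r assume r: "0 \<le> r" "r < 1"
      and contr: "\<forall>x x'. (\<integral>\<^sup>+\<omega>. ennreal (dist (F x (W 1 \<omega>)) (F x' (W 1 \<omega>))) \<partial>M) \<le> ennreal (r * dist x x')"
    have "(\<integral>\<^sup>+w. ennreal (dist (F x w) (F y w)) \<partial>\<gamma>) \<le> ennreal (r * dist x y)" for x y
    proof -
      have "(\<integral>\<^sup>+w. ennreal (dist (F x w) (F y w)) \<partial>distr M G (W 1)) = (\<integral>\<^sup>+\<omega>. ennreal (dist (F x (W 1 \<omega>)) (F y (W 1 \<omega>))) \<partial>M)"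
        by (rule nn_integral_distr[OF rv]) (use F_meas in measurable)
      then show ?thesis using contr by (simp add: W_law)
    qed
    from \<gamma>.dissipative_rds_of_contraction[OF F r this \<delta> K exp_le] show ?thesis by blast
  next
    fix S :: real assume S: "0 \<le> S"
      and summ: "\<forall>x x'. (\<Sum>n. \<integral>\<^sup>+\<omega>. ennreal (dist (rds F W (Suc n) x \<omega>) (rds F W (Suc n) x' \<omega>)) \<partial>M) \<le> ennreal (S * dist x x')"
    then have "(\<Sum>j. separation \<gamma> F (Suc j) x y) \<le> ennreal (S * dist x y)" for x y
      unfolding sep by blast
    from \<gamma>.dissipative_rds_of_summable[OF F S this \<delta> K exp_le] show ?thesis by blast
  qed
  then obtain V L where "dissipative_rds \<gamma> F V L \<delta> K" by blast
  then interpret dissipative_rds \<gamma> F V L \<delta> K .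
  have path_law: "path_law M F W n x = path_measure n x" if n: "n \<ge> 1" for n x
  proof -
    have "path_measure n x = distr (distr M (noise \<gamma> n) (\<lambda>\<omega>. \<lambda>i\<in>{Suc 0..n}. W i \<omega>)) (path_space n) (trajectory F n x)"
      unfolding path_measure_def law(2)[OF n] ..
    also have "\<dots> = distr M (path_space n) (trajectory F n x \<circ> (\<lambda>\<omega>. \<lambda>i\<in>{Suc 0..n}. W i \<omega>))"
      by (rule distr_distr[OF measurable_trajectory[OF F] law(1)[OF n]])
    also have "trajectory F n x \<circ> (\<lambda>\<omega>. \<lambda>i\<in>{Suc 0..n}. W i \<omega>) = (\<lambda>\<omega>. \<lambda>k\<in>{1..n}. rds F W k x \<omega>)"
      unfolding trajectory_def comp_def
      by (intro ext restrict_ext, subst (2) rds_eq_state, rule state_cong) auto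
    finally show ?thesis unfolding path_law_def by (rule sym)
  qed
  show ?thesis
  \<comment> \<open>The constant is built from \<open>L\<close>, \<open>K\<close> and
    \<open>\<delta>\<close> alone, hence uniform in \<open>x\<close>, \<open>n\<close> and
    \<open>Q\<close>.\<close>
  proof (intro exI[of _ "4 * L\<^sup>2 * ((1 + 4 * K) / \<delta>)"] conjI allI impI)
    show "0 < 4 * L\<^sup>2 * ((1 + 4 * K) / \<delta>)" using L_pos \<delta> K by simp
  qed (simp only: path_law, blast intro: transport_entropy_inequality)
qed

end
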